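(* Fix a finite generating set of the group $2V$. For $x\in 2V$ let $|x|$ denote the word length of $x$ with respect to this generating set, and let $N(x)$ be the minimal number of carets of a tree-pair representative of $x$. Then: (i) There is a constant $C>0$ such that for every non-identity element $x\in 2V$, $$ \log N(x)\;\le\; C\,|x| \qquad\text{and}\qquad |x|\;\le\; C\,\bigl(N(x)\log N(x)+1\bigr). $$ (ii) These bounds cannot be improved (in order of magnitude): there are a constant $C'>0$ and a sequence of elements $x_k\in 2V$ with $N(x_k)\to\infty$ and $|x_k|\le C'\log N(x_k)$ for all $k$; and there are a constant $c>0$ and a sequence of elements $y_k\in 2V$ with $N(y_k)\to\infty$ and $|y_k|\ge c\,N(y_k)\log N(y_k)$ for all $k$.
   Context: The group $2V$ (Brin's two-dimensional Thompson group). Work in the unit square, using half-open dyadic rectangles $(\frac{i}{2^r},\frac{i+1}{2^r}]\times(\frac{j}{2^s},\frac{j+1}{2^s}]$ with integers $r,s\ge 0$, $0\le i<2^r$, $0\le j<2^s$, so that maps are defined pointwise on $(0,1]^2$. A dyadic rectangle may be halved by a vertical subdivision (into its left and right halves) or by a horizontal subdivision (into its bottom and top halves). A two-type tree is a finite rooted binary tree each of whose carets (an interior vertex together with its two downward edges) is labelled "vertical" or "horizontal". It encodes a partition of the unit square into dyadic rectangles: the root corresponds to the whole square; a vertical caret halves the corresponding rectangle vertically, with left child the left half and right child the right half; a horizontal caret halves it horizontally, with left child the bottom half and right child the top half. The leaves correspond to the rectangles of the partition and are numbered from left to right as leaves of the tree. A tree-pair diagram is a triple $(T_+,\pi,T_-)$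 where $T_+,T_-$ are two-type trees with the same number $k$ of leaves and $\pi$ is a permutation of the $k$ leaf labels. It represents the bijection of the square which maps, for each leaf label $i$, the rectangle of leaf $i$ of $T_+$ onto the rectangle of leaf $\pi(i)$ of $T_-$ by the affine map of the form $(u,v)\mapsto(au+b,\,cv+d)$ with $a,c>0$. The group $2V$ is the group of all such bijections under composition; it is finitely generated. Different diagrams can represent the same element. The number of carets of a tree-pair diagram is the number of carets in each of its two trees (equal to the number of leaves minus one). Here $\log$ is the natural logarithm. *)

theory Defs
  imports Complex_Main "HOL-Algebra.Bij" "HOL-Algebra.Generated_Groups"
    "HOL-Combinatorics.Permutations"
begin

definition unit_square :: "(real \<times> real) set" where
  "unit_square = {0<..1} \<times> {0<..1}"

(* DRect i r j s encodes the dyadic rectangle (i/2^r, (i+1)/2^r] x (j/2^s, (j+1)/2^s]. *)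
datatype drect = DRect nat nat nat nat

fun region :: "drect \<Rightarrow> (real \<times> real) set" where
  "region (DRect i r j s) =
     {real i / 2 ^ r <.. (real i + 1) / 2 ^ r} \<times> {real j / 2 ^ s <.. (real j + 1) / 2 ^ s}"

datatype caret_type = Vertical | Horizontal

(* A vertical caret cuts the first coordinate interval in half, a horizontal caret the second. *)
fun first_half :: "caret_type \<Rightarrow> drect \<Rightarrow> drect" where
  "first_half Vertical (DRect i r j s) = DRect (2 * i) (r + 1) j s"
| "first_half Horizontal (DRect i r j s) = DRect i r (2 * j) (s + 1)"

fun second_half :: "caret_type \<Rightarrow> drect \<Rightarrow> drect" where
  "second_half Vertical (DRect i r j s) = DRect (2 * i + 1) (r + 1) j s"
| "second_half Horizontal (DRect i r j s) = DRect i r (2 * j + 1) (s + 1)"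

datatype two_type_tree = Leaf | Caret caret_type two_type_tree two_type_tree

fun carets :: "two_type_tree \<Rightarrow> nat" where
  "carets Leaf = 0"
| "carets (Caret c l r) = carets l + carets r + 1"

fun num_leaves :: "two_type_tree \<Rightarrow> nat" where
  "num_leaves Leaf = 1"
| "num_leaves (Caret c l r) = num_leaves l + num_leaves r"

fun subdivide :: "two_type_tree \<Rightarrow> drect \<Rightarrow> drect list" where
  "subdivide Leaf R = [R]"
| "subdivide (Caret c l r) R = subdivide l (first_half c R) @ subdivide r (second_half c R)"

(* Leaves are numbered from left to right, starting at 0. *)
definition leaf_region :: "two_type_tree \<Rightarrow> nat \<Rightarrow> (real \<times> real) set" where
  "leaf_region T i = region (subdivide T (DRect 0 0 0 0) ! i)"

lemma region_root: "region (DRect 0 0 0 0) = unit_square"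
  by (simp add: unit_square_def)

lemma region_halves:
  "region R = region (first_half c R) \<union> region (second_half c R)"
  "region (first_half c R) \<inter> region (second_half c R) = {}"
  by (cases R; cases c; auto simp: field_simps)+

lemma length_subdivide: "length (subdivide T R) = num_leaves T"
  by (induction T arbitrary: R) auto

lemma num_leaves_eq: "num_leaves T = carets T + 1"
  by (induction T) auto

type_synonym tree_pair = "two_type_tree \<times> (nat \<Rightarrow> nat) \<times> two_type_tree"

fun tree_pair_diagram :: "tree_pair \<Rightarrow> bool" where
  "tree_pair_diagram (T, p, T') \<longleftrightarrow>
     num_leaves T = num_leaves T' \<and> p permutes {..<num_leaves T}"

definition maps_affinely ::
    "(real \<times> real \<Rightarrow> real \<times> real) \<Rightarrow> (real \<times> real) set \<Rightarrow> (real \<times> real) set \<Rightarrow> bool" where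
  "maps_affinely f R R' \<longleftrightarrow> f ` R = R' \<and>
     (\<exists>a b c d. a > 0 \<and> c > 0 \<and> (\<forall>(u, v)\<in>R. f (u, v) = (a * u + b, c * v + d)))"

(* Elements of Bij unit_square are extensional, that is, undefined outside the square, so a
   diagram represents exactly one function. *)
fun represents :: "tree_pair \<Rightarrow> (real \<times> real \<Rightarrow> real \<times> real) \<Rightarrow> bool" where
  "represents (T, p, T') f \<longleftrightarrow> f \<in> Bij unit_square \<and>
     (\<forall>i<num_leaves T. maps_affinely f (leaf_region T i) (leaf_region T' (p i)))"

definition Brin_2V :: "(real \<times> real \<Rightarrow> real \<times> real) monoid" where
  "Brin_2V = (BijGroup unit_square)
     \<lparr>carrier := {f. \<exists>D. tree_pair_diagram D \<and> represents D f}\<rparr>"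

fun diagram_carets :: "tree_pair \<Rightarrow> nat" where
  "diagram_carets (T, p, T') = carets T"

definition min_carets :: "(real \<times> real \<Rightarrow> real \<times> real) \<Rightarrow> nat" where
  "min_carets f =
     (LEAST n. \<exists>D. tree_pair_diagram D \<and> represents D f \<and> diagram_carets D = n)"

(* Meaningful only if S generates G and x is in G; otherwise LEAST may range over nothing. *)
definition word_length :: "('a, 'b) monoid_scheme \<Rightarrow> 'a set \<Rightarrow> 'a \<Rightarrow> nat" where
  "word_length G S x =
     (LEAST n. \<exists>ws. length ws = n \<and> set ws \<subseteq> S \<union> (\<lambda>s. inv\<^bsub>G\<^esub> s) ` S \<and>
        foldr (\<otimes>\<^bsub>G\<^esub>) ws \<one>\<^bsub>G\<^esub> = x)"

end

theory Submission
  imports Defs "HOL-Library.Sublist"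
begin

text \<open>\<^bold>\<open>Idea.\<close> An element \<open>x\<close> of 2V is a bijection of the square for which some finite partition of the
  square into dyadic rectangles is carried, rectangle by rectangle, to dyadic rectangles by affine
  maps that are increasing in each coordinate. Trees can be forgotten: every dyadic partition of the square comes from
  a two-type tree (\<open>partition_tree\<close>), because a square with more than one cell can be cut by its vertical
  or by its horizontal middle line without crossing a cell. So \<open>N(x) + 1\<close> is the least number of
  cells of a partition on which \<open>x\<close> is of this form (\<open>diagram_iff_pieces\<close>), and a partition may be
  refined, intersected and mapped without any bookkeeping of leaf orders.

  \<^bold>\<open>Lower bound.\<close> The common refinement of partitions with \<open>m\<close> and \<open>n\<close> cells has at most
  \<open>m * n\<close> cells, so \<open>N + 1\<close> is submultiplicative and grows at most exponentially in the word
  length. Exponential growth occurs for the powers of the baker's map: on every vertical strip its \<open>k\<close>-th power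
  stretches the first coordinate by \<open>2 ^ k\<close>, so every cell has width at most
  \<open>2 ^ - k\<close>, which forces \<open>2 ^ k\<close> cells.

  \<^bold>\<open>Upper bound.\<close> For each \<open>n\<close> there is a standard partition \<open>heap_level n\<close> into \<open>n\<close> vertical strips,
  namely the nodes \<open>n, ..., 2 n - 1\<close> of the infinite binary tree numbered like a binary heap; its
  depth is at most \<open>1 + log 2 n\<close>, and the level \<open>n + 1\<close> arises from the level \<open>n\<close> by halving the single
  strip \<open>n\<close>. An element swapping two strips of the level has word length \<open>O(log n)\<close>: move
  the two strips to two fixed strips, which takes a bounded number of generators per letter of their
  addresses, swap those, and move back (\<open>swaps_bounded\<close>). A tree with \<open>n\<close> leaves is carried to the level \<open>n\<close>
  by an element of length \<open>O(n log n)\<close>, by induction on the tree: remove a caret, bring the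
  corresponding strip to position \<open>n\<close> by one swap, and halve it, after turning a horizontal
  cut into a vertical one if necessary (\<open>tree_to_heap\<close>). Comparing domain and range trees of \<open>x\<close> with
  the level in this way leaves a permutation of the \<open>n\<close> strips, which is a product of at most \<open>n\<close>
  swaps.

  \<^bold>\<open>Sharpness of the upper bound.\<close> The \<open>n!\<close> permutations of the cells of one partition into \<open>n\<close> cells give
  \<open>n!\<close> elements with fewer than \<open>n\<close> carets, while only exponentially many elements (in \<open>l\<close>) have word
  length at most \<open>l\<close>; so one of them has length at least a constant times \<open>log (n!)\<close>.\<close>

section \<open>Dyadic rectangles as affine embeddings of the square\<close>

abbreviation root :: drect where
  "root \<equiv> DRect 0 0 0 0"

fun valid :: "drect \<Rightarrow> bool" where
  "valid (DRect i r j s) \<longleftrightarrow> i < 2 ^ r \<and> j < 2 ^ s"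

text \<open>The affine map with positive diagonal linear part from the unit square onto the rectangle. Two
  rectangles \<open>R\<close> and \<open>R'\<close> are related by the map of a diagram exactly when it sends \<open>emb R z\<close> to
  \<open>emb R' z\<close>; this removes all affine arithmetic from the arguments below.\<close>
fun emb :: "drect \<Rightarrow> real \<times> real \<Rightarrow> real \<times> real" where
  "emb (DRect i r j s) z = ((real i + fst z) / 2 ^ r, (real j + snd z) / 2 ^ s)"

text \<open>The rectangle that has the same position inside \<open>R\<close> as \<open>Q\<close> has inside the square. This is
  composition of embeddings (\<open>emb_dmul\<close>), so the dyadic rectangles form a monoid in which passing to a
  subrectangle is multiplication from the right.\<close>
fun dmul :: "drect \<Rightarrow> drect \<Rightarrow> drect" (infixl "\<odot>" 70) where
  "DRect i r j s \<odot> DRect k a l b = DRect (i * 2 ^ a + k) (r + a) (j * 2 ^ b + l) (s + b)"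

fun half :: "caret_type \<Rightarrow> bool \<Rightarrow> drect" where
  "half Vertical b = DRect (of_bool b) 1 0 0"
| "half Horizontal b = DRect 0 0 (of_bool b) 1"

lemma emb_dmul: "emb (R \<odot> Q) z = emb R (emb Q z)"
  by (cases R; cases Q) (simp add: field_simps power_add)

lemma dmul_root [simp]: "root \<odot> R = R" "R \<odot> root = R"
  by (cases R; simp)+

lemma dmul_assoc: "R \<odot> Q \<odot> X = R \<odot> (Q \<odot> X)"
  by (cases R; cases Q; cases X) (simp add: algebra_simps power_add)

lemma first_half_eq: "first_half c R = R \<odot> half c False"
  by (cases R; cases c) simp_all

lemma second_half_eq: "second_half c R = R \<odot> half c True"
  by (cases R; cases c) simp_all

lemma region_emb: "region R = emb R ` unit_square"
proof (cases R)
  case (DRect i r j s)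
  show ?thesis
  proof (intro equalityI subsetI)
    fix z assume z: "z \<in> region R"
    define y where "y = (2 ^ r * fst z - real i, 2 ^ s * snd z - real j)"
    have "emb R y = z" by (simp add: DRect y_def)
    moreover have "y \<in> unit_square"
      using z by (auto simp: DRect y_def unit_square_def field_simps)
    ultimately show "z \<in> emb R ` unit_square" by (metis imageI)
  qed (auto simp: DRect unit_square_def divide_right_mono divide_strict_right_mono)
qed

lemma emb_inj: "emb R z = emb R z' \<longleftrightarrow> z = z'"
  by (cases R) (auto simp: prod_eq_iff)

lemma region_mul: "region (R \<odot> Q) = emb R ` region Q"
  by (auto simp: region_emb emb_dmul image_image)

lemma emb_in_region [simp]: "emb R z \<in> region R \<longleftrightarrow> z \<in> unit_square"
  by (auto simp: region_emb emb_inj)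

lemma emb_in_region_mul [simp]: "emb R z \<in> region (R \<odot> Q) \<longleftrightarrow> z \<in> region Q"
  by (auto simp: region_mul emb_inj)

lemma one_one_in_square [simp]: "(1, 1) \<in> unit_square"
  by (simp add: unit_square_def)

lemma half_half_in_square [simp]: "(1/2, 1/2) \<in> unit_square"
  by (simp add: unit_square_def)

lemma dyadic_interval_inj:
  assumes "(real i + 1) / 2 ^ r = (real i' + 1) / 2 ^ r'"
    and "(real i + 1/2) / 2 ^ r = (real i' + 1/2) / 2 ^ r'"
  shows "i = i'" "r = r'"
proof -
  have "(1/2) / 2 ^ r = (real i + 1) / 2 ^ r - (real i + 1/2) / 2 ^ r"
    by (simp flip: diff_divide_distrib)
  also have "\<dots> = (real i' + 1) / 2 ^ r' - (real i' + 1/2) / 2 ^ r'"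
    using assms by simp
  also have "\<dots> = (1/2) / 2 ^ r'" by (simp flip: diff_divide_distrib)
  finally have "(2::real) ^ r = 2 ^ r'" by simp
  then show "r = r'" by simp
  then show "i = i'" using assms by simp
qed

text \<open>The images of the corner and of the centre of the square suffice to recover position and size.\<close>
lemma emb_determines:
  assumes "\<And>z. z \<in> unit_square \<Longrightarrow> emb R z = emb R' z"
  shows "R = R'"
proof (cases R; cases R')
  fix i r j s i' r' j' s'
  assume "R = DRect i r j s" "R' = DRect i' r' j' s'"
  then show ?thesis
    using assms[of "(1,1)"] assms[of "(1/2,1/2)"]
    by (auto dest: dyadic_interval_inj)
qed

lemma dmul_left_cancel: "R \<odot> Q = R \<odot> Q' \<longleftrightarrow> Q = Q'"
  by (metis emb_determines emb_dmul emb_inj)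

lemma valid_emb: "valid R \<longleftrightarrow> region R \<subseteq> unit_square"
proof (cases R)
  case (DRect i r j s)
  have *: "real i + 1 \<le> 2 ^ r \<longleftrightarrow> i < 2 ^ r" for i r :: nat
    by (metis Suc_eq_plus1 Suc_le_eq of_nat_1 of_nat_add of_nat_le_iff of_nat_numeral of_nat_power)
  show ?thesis
  proof
    assume "valid R"
    then have "real i + 1 \<le> 2 ^ r" "real j + 1 \<le> 2 ^ s" by (auto simp: DRect *)
    then show "region R \<subseteq> unit_square"
      apply (auto simp: DRect unit_square_def)
         apply (smt (verit) divide_nonneg_pos of_nat_0_le_iff zero_less_power)
        apply (smt (verit) divide_le_eq_1_pos zero_less_power)
       apply (smt (verit) divide_nonneg_pos of_nat_0_le_iff zero_less_power)
      apply (smt (verit) divide_le_eq_1_pos zero_less_power)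
      done
  next
    assume "region R \<subseteq> unit_square"
    then have "emb R (1,1) \<in> unit_square" by (auto simp: region_emb)
    then show "valid R" by (auto simp: DRect unit_square_def field_simps simp flip: *)
  qed
qed

lemma emb_in_square: "valid R \<Longrightarrow> z \<in> unit_square \<Longrightarrow> emb R z \<in> unit_square"
  using valid_emb region_emb by blast

lemma region_mul_subset: "valid Q \<Longrightarrow> region (R \<odot> Q) \<subseteq> region R"
  unfolding region_mul valid_emb region_emb[of R] by (rule image_mono)

lemma valid_mul: "valid R \<Longrightarrow> valid Q \<Longrightarrow> valid (R \<odot> Q)"
  using region_mul_subset valid_emb by blast

lemma valid_half [simp]: "valid (half c b)"
  by (cases c) auto

lemma region_nonempty: "region R \<noteq> {}"
  by (auto simp: region_emb unit_square_def)

section \<open>Dyadic partitions\<close>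

definition dyadic_partition :: "drect set \<Rightarrow> bool" where
  "dyadic_partition P \<longleftrightarrow> finite P \<and> (\<forall>R\<in>P. valid R) \<and>
     (\<forall>z\<in>unit_square. \<exists>!R. R \<in> P \<and> z \<in> region R)"

lemma partition_disjoint:
  assumes "dyadic_partition P" "R \<in> P" "R' \<in> P" "z \<in> region R" "z \<in> region R'"
  shows "R = R'"
  using assms unfolding dyadic_partition_def valid_emb by blast

lemma partition_disjoint':
  assumes "dyadic_partition P" "R \<in> P" "R' \<in> P" "R \<noteq> R'"
  shows "region R \<inter> region R' = {}"
  using assms partition_disjoint by blast

lemma partition_cell:
  assumes "dyadic_partition P" "z \<in> unit_square"
  obtains R where "R \<in> P" "z \<in> region R"
  using assms unfolding dyadic_partition_def by blast

lemma partition_finite: "dyadic_partition P \<Longrightarrow> finite P"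
  by (simp add: dyadic_partition_def)

lemma partition_valid: "dyadic_partition P \<Longrightarrow> R \<in> P \<Longrightarrow> valid R"
  by (simp add: dyadic_partition_def)

lemma partition_nonempty: "dyadic_partition P \<Longrightarrow> P \<noteq> {}"
  using one_one_in_square partition_cell by blast

lemma partition_card_pos: "dyadic_partition P \<Longrightarrow> card P > 0"
  by (simp add: partition_finite partition_nonempty card_gt_0_iff)

lemma partition_root: "dyadic_partition {root}"
  by (auto simp: dyadic_partition_def region_emb)

lemma partition_halves: "dyadic_partition {half c False, half c True}"
proof -
  have "region (half c False) \<union> region (half c True) = unit_square"
    and "region (half c False) \<inter> region (half c True) = {}"
    using region_halves(1)[of root c] region_halves(2)[of c root] region_root by (simp_all add: first_half_eq second_half_eq)
  then show ?thesis unfolding dyadic_partition_def by auto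
qed

lemma half_inj: "half c b = half c b' \<longleftrightarrow> b = b'"
  by (cases c) auto

text \<open>Substituting partitions into the cells of a partition. Joining two halves, halving one cell
  and common refinements are all instances.\<close>
lemma partition_graft:
  assumes P: "dyadic_partition P" and Q: "\<And>R. R \<in> P \<Longrightarrow> dyadic_partition (Q R)"
  shows "dyadic_partition (\<Union>R\<in>P. (\<odot>) R ` Q R)"
    and "card (\<Union>R\<in>P. (\<odot>) R ` Q R) = (\<Sum>R\<in>P. card (Q R))"
proof -
  have in_reg: "region (R \<odot> Z) \<subseteq> region R" if "R \<in> P" "Z \<in> Q R" for R Z
    using that partition_valid Q region_mul_subset by blast
  show "dyadic_partition (\<Union>R\<in>P. (\<odot>) R ` Q R)"
    unfolding dyadic_partition_def
  proof (intro conjI ballI)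
    show "finite (\<Union>R\<in>P. (\<odot>) R ` Q R)"
      using P Q by (auto simp: partition_finite)
    show "valid X" if "X \<in> (\<Union>R\<in>P. (\<odot>) R ` Q R)" for X
      using that P Q partition_valid valid_mul by blast
    fix z assume z: "z \<in> unit_square"
    obtain R where R: "R \<in> P" "z \<in> region R" using P z by (rule partition_cell)
    then obtain y where y: "z = emb R y" "y \<in> unit_square" by (auto simp: region_emb)
    obtain Z where Z: "Z \<in> Q R" "y \<in> region Z" using Q[OF R(1)] y(2) by (rule partition_cell)
    show "\<exists>!X. X \<in> (\<Union>R\<in>P. (\<odot>) R ` Q R) \<and> z \<in> region X"
    proof (rule ex1I[of _ "R \<odot> Z"])
      show "R \<odot> Z \<in> (\<Union>R\<in>P. (\<odot>) R ` Q R) \<and> z \<in> region (R \<odot> Z)"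
        using R Z y by auto
      fix X assume "X \<in> (\<Union>R\<in>P. (\<odot>) R ` Q R) \<and> z \<in> region X"
      then obtain R' Z' where X: "R' \<in> P" "Z' \<in> Q R'" "X = R' \<odot> Z'" "z \<in> region (R' \<odot> Z')"
        by auto
      then have "R' = R" using in_reg partition_disjoint P R by blast
      with X have "Z' \<in> Q R" "y \<in> region Z'" by (auto simp: y)
      then have "Z' = Z" using Z Q[OF R(1)] partition_disjoint by blast
      then show "X = R \<odot> Z" using X \<open>R' = R\<close> by simp
    qed
  qed
  have "R = R'" if "R \<in> P" "R' \<in> P" "Z \<in> Q R" "Z' \<in> Q R'" "R \<odot> Z = R' \<odot> Z'" for R R' Z Z'
    using that in_reg P partition_disjoint region_nonempty by (metis ex_in_conv subsetD)
  then have "card (\<Union>R\<in>P. (\<odot>) R ` Q R) = (\<Sum>R\<in>P. card ((\<odot>) R ` Q R))"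
    using P Q by (intro card_UN_disjoint) (auto simp: partition_finite)
  also have "\<dots> = (\<Sum>R\<in>P. card (Q R))"
    by (intro sum.cong refl card_image) (auto simp: inj_on_def dmul_left_cancel)
  finally show "card (\<Union>R\<in>P. (\<odot>) R ` Q R) = (\<Sum>R\<in>P. card (Q R))" .
qed

lemma partition_join:
  assumes "dyadic_partition P0" "dyadic_partition P1"
  shows "dyadic_partition ((\<odot>) (half c False) ` P0 \<union> (\<odot>) (half c True) ` P1)"
    and "card ((\<odot>) (half c False) ` P0 \<union> (\<odot>) (half c True) ` P1) = card P0 + card P1"
  using partition_graft[of "{half c False, half c True}"
      "\<lambda>R. if R = half c False then P0 else P1"] assms partition_halves
  by (auto simp: half_inj)

lemma partition_split_cell:
  assumes P: "dyadic_partition P" and R: "R \<in> P"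
  shows "dyadic_partition (P - {R} \<union> {R \<odot> half c False, R \<odot> half c True})"
    and "card (P - {R} \<union> {R \<odot> half c False, R \<odot> half c True}) = card P + 1"
proof -
  let ?Q = "\<lambda>X. if X = R then {half c False, half c True} else {root}"
  have eq: "(\<Union>X\<in>P. (\<odot>) X ` ?Q X) = P - {R} \<union> {R \<odot> half c False, R \<odot> half c True}"
    using R by (auto split: if_splits)
  show "dyadic_partition (P - {R} \<union> {R \<odot> half c False, R \<odot> half c True})"
    using partition_graft(1)[OF P, of ?Q] partition_halves partition_root unfolding eq by auto
  have "card (P - {R} \<union> {R \<odot> half c False, R \<odot> half c True}) = (\<Sum>X\<in>P. card (?Q X))"
    using partition_graft(2)[OF P, of ?Q] partition_halves partition_root unfolding eq by auto
  also have "\<dots> = (\<Sum>X\<in>P. 1 + (if X = R then 1 else 0))"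
    by (intro sum.cong refl) (auto simp: half_inj)
  also have "\<dots> = card P + 1"
    unfolding sum.distrib using R P by (simp add: partition_finite)
  finally show "card (P - {R} \<union> {R \<odot> half c False, R \<odot> half c True}) = card P + 1" .
qed

text \<open>Dyadic intervals that meet are nested.\<close>
lemma dyadic_interval_meet:
  fixes i i' r r' :: nat
  assumes "{real i / 2 ^ r <.. (real i + 1) / 2 ^ r} \<inter> {real i' / 2 ^ r' <.. (real i' + 1) / 2 ^ r'} \<noteq> {}"
    and "r \<le> r'"
  shows "\<exists>k < 2 ^ (r' - r). i' = i * 2 ^ (r' - r) + k"
proof -
  define a where "a = r' - r"
  have r': "r' = r + a" using assms by (simp add: a_def)
  obtain x where x: "real i / 2 ^ r < x" "x \<le> (real i + 1) / 2 ^ r"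
      "real i' / 2 ^ r' < x" "x \<le> (real i' + 1) / 2 ^ r'" using assms(1) by (fastforce simp only: ex_in_conv[symmetric] Int_iff greaterThanAtMost_iff)
  define y where "y = x * 2 ^ r'"
  have "real i * 2 ^ a < y" "y \<le> (real i + 1) * 2 ^ a" "real i' < y" "y \<le> real i' + 1"
    using x mult_strict_right_mono[of "real i" "x * 2 ^ r" "2 ^ a"]
      mult_right_mono[of "x * 2 ^ r" "real i + 1" "2 ^ a"]
    by (simp_all add: y_def r' power_add field_simps)
  then have "real i * 2 ^ a < real i' + 1" "real i' < (real i + 1) * 2 ^ a" by linarith+
  then have "real (i * 2 ^ a) < real (i' + 1)" "real i' < real ((i + 1) * 2 ^ a)" by (simp_all add: algebra_simps)
  then have "i * 2 ^ a < i' + 1" "i' < (i + 1) * 2 ^ a" by (simp_all only: of_nat_less_iff)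
  then show ?thesis
    by (intro exI[of _ "i' - i * 2 ^ a"]) (auto simp: a_def[symmetric] algebra_simps)
qed

text \<open>Coordinatewise nesting makes the intersection of two dyadic rectangles a dyadic rectangle, and
  thus a right multiple of both. Neither rectangle need contain the other.\<close>
lemma region_meet:
  assumes "region R \<inter> region R' \<noteq> {}"
  obtains Z Z' where "valid Z" "valid Z'" "R \<odot> Z = R' \<odot> Z'"
    "region (R \<odot> Z) = region R \<inter> region R'"
proof (cases R; cases R')
  fix i r j s i' r' j' s'
  assume R: "R = DRect i r j s" "R' = DRect i' r' j' s'"
  let ?I = "\<lambda>i r. {real i / 2 ^ r <.. (real i + 1) / 2 ^ r}"
  have 1: "?I i r \<inter> ?I i' r' \<noteq> {}" "?I j s \<inter> ?I j' s' \<noteq> {}"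
    using assms by (auto simp: R)
  have ex: "\<exists>k a k' a'. k < 2 ^ a \<and> k' < 2 ^ a' \<and> i * 2 ^ a + k = i' * 2 ^ a' + k' \<and>
      r + a = r' + a' \<and> (a = 0 \<or> a' = 0)"
    if "?I i r \<inter> ?I i' r' \<noteq> {}" for i r i' r'
  proof (cases "r \<le> r'")
    case True
    from dyadic_interval_meet[OF that True] obtain k
      where "k < 2 ^ (r' - r)" "i' = i * 2 ^ (r' - r) + k" by auto
    then show ?thesis
      by (intro exI[of _ k] exI[of _ "r' - r"] exI[of _ 0]) (use True in auto)
  next
    case False
    then have "r' \<le> r" by simp
    from dyadic_interval_meet[OF _ this] that obtain k
      where "k < 2 ^ (r - r')" "i = i' * 2 ^ (r - r') + k" by (metis inf_commute)
    then show ?thesis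
      by (intro exI[of _ 0] exI[of _ 0] exI[of _ k] exI[of _ "r - r'"]) (use False in auto)
  qed
  from ex[OF 1(1)] obtain k a k' a' where a: "k < 2 ^ a" "k' < 2 ^ a'"
    "i * 2 ^ a + k = i' * 2 ^ a' + k'" "r + a = r' + a'" "a = 0 \<or> a' = 0" by blast
  from ex[OF 1(2)] obtain l b l' b' where b: "l < 2 ^ b" "l' < 2 ^ b'"
    "j * 2 ^ b + l = j' * 2 ^ b' + l'" "s + b = s' + b'" "b = 0 \<or> b' = 0" by blast
  have shr: "?I (i * 2 ^ a + k) (r + a) \<subseteq> ?I i r" if "k < 2 ^ a" for i a k r
  proof -
    have "real k + 1 \<le> 2 ^ a"
      using that by (metis Suc_eq_plus1 Suc_le_eq of_nat_1 of_nat_add of_nat_le_iff of_nat_numeral of_nat_power)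
    then have "real i / 2 ^ r \<le> real (i * 2 ^ a + k) / 2 ^ (r + a)"
      and "(real (i * 2 ^ a + k) + 1) / 2 ^ (r + a) \<le> (real i + 1) / 2 ^ r"
      using mult_right_mono[of "1 + real k" "2 ^ a" "2 ^ r"] by (simp_all add: power_add field_simps)
    then show ?thesis
      unfolding subset_iff greaterThanAtMost_iff by linarith
  qed
  have I: "?I (i * 2 ^ a + k) (r + a) = ?I i r \<inter> ?I i' r'"
    
  proof -
    have 1: "?I (i * 2 ^ a + k) (r + a) = ?I (i' * 2 ^ a' + k') (r' + a')"
      by (simp only: a(3,4))
    have "?I (i * 2 ^ a + k) (r + a) = ?I i r \<or> ?I (i' * 2 ^ a' + k') (r' + a') = ?I i' r'"
      using a(1,2,5) by auto
    then show ?thesis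
      using shr[OF a(1), of i r] shr[OF a(2), of i' r'] 1 by blast
  qed
  have J: "?I (j * 2 ^ b + l) (s + b) = ?I j s \<inter> ?I j' s'"
    
  proof -
    have 1: "?I (j * 2 ^ b + l) (s + b) = ?I (j' * 2 ^ b' + l') (s' + b')"
      by (simp only: b(3,4))
    have "?I (j * 2 ^ b + l) (s + b) = ?I j s \<or> ?I (j' * 2 ^ b' + l') (s' + b') = ?I j' s'"
      using b(1,2,5) by auto
    then show ?thesis
      using shr[OF b(1), of j s] shr[OF b(2), of j' s'] 1 by blast
  qed
  show ?thesis
  proof (rule that[of "DRect k a l b" "DRect k' a' l' b'"])
    show "R \<odot> DRect k a l b = R' \<odot> DRect k' a' l' b'" using a b by (simp add: R)
    show "region (R \<odot> DRect k a l b) = region R \<inter> region R'"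
      unfolding R dmul.simps region.simps I J by auto
  qed (use a b in auto)
qed

text \<open>The partition that \<open>Q\<close> induces on the cell \<open>R\<close>, seen in the coordinates of \<open>R\<close>.\<close>
lemma partition_trace:
  assumes Q: "dyadic_partition Q" and R: "valid R"
  obtains P where "dyadic_partition P" "card P \<le> card Q"
    "\<And>Z. Z \<in> P \<Longrightarrow> \<exists>R'\<in>Q. \<exists>Z'. valid Z' \<and> R \<odot> Z = R' \<odot> Z'"
proof -
  define M where "M = {R' \<in> Q. region R \<inter> region R' \<noteq> {}}"
  have "\<exists>Z. valid Z \<and> (\<exists>Z'. valid Z' \<and> R \<odot> Z = R' \<odot> Z') \<and>
      region (R \<odot> Z) = region R \<inter> region R'" if "R' \<in> M" for R'
    proof -
    have "region R \<inter> region R' \<noteq> {}" using that by (simp add: M_def)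
    then show ?thesis by (rule region_meet) blast
  qed
  then obtain f where f: "\<And>R'. R' \<in> M \<Longrightarrow> valid (f R')"
    "\<And>R'. R' \<in> M \<Longrightarrow> \<exists>Z'. valid Z' \<and> R \<odot> f R' = R' \<odot> Z'"
    "\<And>R'. R' \<in> M \<Longrightarrow> region (R \<odot> f R') = region R \<inter> region R'" by metis
  have fin: "finite M" "M \<subseteq> Q" using Q by (auto simp: M_def partition_finite)
  show ?thesis
  proof (rule that[of "f ` M"])
    have "card (f ` M) \<le> card M" using fin by (intro card_image_le)
    also have "\<dots> \<le> card Q" using fin Q by (intro card_mono partition_finite)
    finally show "card (f ` M) \<le> card Q" .
    show "\<exists>R'\<in>Q. \<exists>Z'. valid Z' \<and> R \<odot> Z = R' \<odot> Z'" if "Z \<in> f ` M" for Z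
      using that f(2) fin(2) by blast
    show "dyadic_partition (f ` M)" unfolding dyadic_partition_def
    proof (intro conjI ballI)
      show "finite (f ` M)" using fin by simp
      show "valid Z" if "Z \<in> f ` M" for Z using that f by blast
      fix z assume z: "z \<in> unit_square"
      obtain R' where R': "R' \<in> Q" "emb R z \<in> region R'"
        using Q emb_in_square[OF R z] by (rule partition_cell)
      then have M: "R' \<in> M" using z by (auto simp: M_def region_emb)
      show "\<exists>!Z. Z \<in> f ` M \<and> z \<in> region Z"
      proof (rule ex1I[of _ "f R'"])
        have "emb R z \<in> region (R \<odot> f R')" using f(3)[OF M] z R' by auto
        then show "f R' \<in> f ` M \<and> z \<in> region (f R')" using M by auto
        fix Z assume "Z \<in> f ` M \<and> z \<in> region Z"
        then obtain R'' where R'': "R'' \<in> M" "Z = f R''" "z \<in> region (f R'')" by auto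
        then have "emb R z \<in> region R''" using f(3)[OF R''(1)] emb_in_region_mul by blast
        then have "R'' = R'" using R' R'' fin Q partition_disjoint by blast
        then show "Z = f R'" using R'' by simp
      qed
    qed
  qed
qed

lemma common_refinement:
  assumes P: "dyadic_partition P" and Q: "dyadic_partition Q"
  obtains I where "dyadic_partition I" "card I \<le> card P * card Q"
    "\<And>X. X \<in> I \<Longrightarrow> \<exists>R\<in>P. \<exists>Z. valid Z \<and> X = R \<odot> Z"
    "\<And>X. X \<in> I \<Longrightarrow> \<exists>R\<in>Q. \<exists>Z. valid Z \<and> X = R \<odot> Z"
proof -
  have "\<exists>T. dyadic_partition T \<and> card T \<le> card Q \<and>
    (\<forall>Z\<in>T. \<exists>R'\<in>Q. \<exists>Z'. valid Z' \<and> R \<odot> Z = R' \<odot> Z')" if "R \<in> P" for R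
    using partition_trace[OF Q partition_valid[OF P that]] by metis
  then obtain T where T: "\<And>R. R \<in> P \<Longrightarrow> dyadic_partition (T R)"
    "\<And>R. R \<in> P \<Longrightarrow> card (T R) \<le> card Q"
    "\<And>R Z. R \<in> P \<Longrightarrow> Z \<in> T R \<Longrightarrow> \<exists>R'\<in>Q. \<exists>Z'. valid Z' \<and> R \<odot> Z = R' \<odot> Z'" by metis
  show ?thesis
  proof (rule that[of "\<Union>R\<in>P. (\<odot>) R ` T R"])
    show "dyadic_partition (\<Union>R\<in>P. (\<odot>) R ` T R)" using P T by (intro partition_graft)
    have "card (\<Union>R\<in>P. (\<odot>) R ` T R) = (\<Sum>R\<in>P. card (T R))" using P T by (intro partition_graft)
    also have "\<dots> \<le> card P * card Q" using sum_bounded_above[of P "\<lambda>R. card (T R)" "card Q"] T by simp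
    finally show "card (\<Union>R\<in>P. (\<odot>) R ` T R) \<le> card P * card Q" .
  qed (use T partition_valid in blast)+
qed

section \<open>Every dyadic partition comes from a tree\<close>

lemma subdivide_mul: "subdivide T R = map ((\<odot>) R) (subdivide T root)"
proof (induction T arbitrary: R)
  case (Caret c l r)
  have "subdivide l (first_half c R) = map ((\<odot>) R) (subdivide l (first_half c root))"
    unfolding Caret.IH(1)[of "first_half c R"] Caret.IH(1)[of "first_half c root"]
    by (simp add: first_half_eq dmul_assoc)
  moreover have "subdivide r (second_half c R) = map ((\<odot>) R) (subdivide r (second_half c root))"
    unfolding Caret.IH(2)[of "second_half c R"] Caret.IH(2)[of "second_half c root"]
    by (simp add: second_half_eq dmul_assoc)
  ultimately show ?case by simp
qed simp

definition leaves :: "two_type_tree \<Rightarrow> drect set" where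
  "leaves T = set (subdivide T root)"

lemma leaves_Leaf: "leaves Leaf = {root}"
  by (simp add: leaves_def)

lemma leaves_Caret:
  "leaves (Caret c l r) = (\<odot>) (half c False) ` leaves l \<union> (\<odot>) (half c True) ` leaves r"
proof -
  have "set (subdivide l (first_half c root)) = (\<odot>) (half c False) ` leaves l"
    by (subst subdivide_mul) (simp add: first_half_eq leaves_def)
  moreover have "set (subdivide r (second_half c root)) = (\<odot>) (half c True) ` leaves r"
    by (subst subdivide_mul) (simp add: second_half_eq leaves_def)
  ultimately show ?thesis by (simp add: leaves_def)
qed

lemma leaves_partition: "dyadic_partition (leaves T)" "card (leaves T) = num_leaves T"
proof -
  have "dyadic_partition (leaves T) \<and> card (leaves T) = num_leaves T"
  proof (induction T)
    case Leaf show ?case by (simp add: leaves_Leaf partition_root)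
  next
    case (Caret c l r)
    then show ?case by (simp only: leaves_Caret partition_join num_leaves.simps)
  qed
  then show "dyadic_partition (leaves T)" "card (leaves T) = num_leaves T" by auto
qed

lemma distinct_subdivide: "distinct (subdivide T root)"
  by (metis card_distinct leaves_def leaves_partition(2) length_subdivide)

fun depth :: "caret_type \<Rightarrow> drect \<Rightarrow> nat" where
  "depth Vertical (DRect i r j s) = r"
| "depth Horizontal (DRect i r j s) = s"

lemma half_factor_1d:
  fixes i r :: nat
  assumes "i < 2 ^ Suc r"
  shows "i = of_bool (2 ^ r \<le> i) * 2 ^ r + i mod 2 ^ r"
proof (cases "2 ^ r \<le> i")
  case True
  then have "i mod 2 ^ r = i - 2 ^ r" using assms by (simp add: le_mod_geq)
  then show ?thesis using True by simp
qed simp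

lemma half_factor:
  assumes "valid R" "depth c R > 0"
  obtains b Z where "valid Z" "R = half c b \<odot> Z"
proof (cases R)
  case (DRect i r j s)
  show ?thesis
  proof (cases c)
    case Vertical
    then obtain r' where r: "r = Suc r'" using assms by (cases r) (auto simp: DRect)
    show ?thesis
      using assms(1) half_factor_1d[of i r']
      by (intro that[of "DRect (i mod 2 ^ r') r' j s" "2 ^ r' \<le> i"])
        (auto simp add: DRect r Vertical simp del: of_bool_eq of_bool_eq_1_iff)
  next
    case Horizontal
    then obtain s' where s: "s = Suc s'" using assms by (cases s) (auto simp: DRect)
    show ?thesis
      using assms(1) half_factor_1d[of j s']
      by (intro that[of "DRect i r (j mod 2 ^ s') s'" "2 ^ s' \<le> j"])
        (auto simp add: DRect s Horizontal simp del: of_bool_eq of_bool_eq_1_iff)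
  qed
qed

text \<open>A cell that crosses the vertical middle line has full width, and a cell that crosses the horizontal middle
  line has full height. Two such cells would meet, so one of the two lines crosses no cell. This fails in
  dimension three.\<close>
lemma guillotine_cut:
  assumes P: "dyadic_partition P" "root \<notin> P"
  obtains c where "\<And>R. R \<in> P \<Longrightarrow> depth c R > 0"
proof -
  have False if R: "R \<in> P" "depth Vertical R = 0" and R': "R' \<in> P" "depth Horizontal R' = 0" for R R'
  proof -
    obtain j s where 1: "R = DRect 0 0 j s"
      using R partition_valid[OF P(1) R(1)] by (cases R) auto
    obtain i r where 2: "R' = DRect i r 0 0"
      using R' partition_valid[OF P(1) R'(1)] by (cases R') auto
    have "emb R (1,1) \<in> unit_square" "emb R' (1,1) \<in> unit_square"
      using emb_in_square partition_valid P R R' by simp_all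
    then have "(fst (emb R' (1,1)), snd (emb R (1,1))) \<in> region R \<inter> region R'"
      by (auto simp: 1 2 unit_square_def divide_strict_right_mono)
    then have "R = R'" using partition_disjoint P R R' by blast
    then have "R = root" by (simp add: 1 2)
    then show False using P R by simp
  qed
  then show ?thesis using that[of Vertical] that[of Horizontal] by blast
qed

lemma partition_unjoin:
  assumes P: "dyadic_partition P" and c: "\<And>R. R \<in> P \<Longrightarrow> depth c R > 0"
  obtains P0 P1 where "dyadic_partition P0" "dyadic_partition P1"
    "P = (\<odot>) (half c False) ` P0 \<union> (\<odot>) (half c True) ` P1"
proof -
  define Q where "Q b = {Z. valid Z \<and> half c b \<odot> Z \<in> P}" for b
  have "dyadic_partition (Q b)" for b
    unfolding dyadic_partition_def
  proof (intro conjI ballI)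
    show "finite (Q b)"
    proof (rule finite_imageD)
      show "finite ((\<odot>) (half c b) ` Q b)"
        by (rule finite_subset[OF _ partition_finite[OF P]]) (auto simp: Q_def)
    qed (auto simp: inj_on_def dmul_left_cancel)
    show "valid Z" if "Z \<in> Q b" for Z using that by (simp add: Q_def)
    fix z assume z: "z \<in> unit_square"
    obtain R where R: "R \<in> P" "emb (half c b) z \<in> region R"
      using P emb_in_square[OF valid_half z] by (rule partition_cell)
    then obtain b' Z where Z: "valid Z" "R = half c b' \<odot> Z"
      using P c by (meson half_factor partition_valid)
    have "b' = b"
    proof -
      have "region R \<subseteq> region (half c b')" using Z region_mul_subset by simp
      then have "emb (half c b) z \<in> region (half c b')" "emb (half c b) z \<in> region (half c b)"
        using R z by auto
      then have "half c b' = half c b"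
        using partition_disjoint[OF partition_halves, of "half c b'" c "half c b"] by (cases b; cases b') auto
      then show ?thesis by (simp add: half_inj)
    qed
    show "\<exists>!Z. Z \<in> Q b \<and> z \<in> region Z"
    proof (rule ex1I[of _ Z])
      show "Z \<in> Q b \<and> z \<in> region Z" using R Z \<open>b' = b\<close> by (auto simp: Q_def)
      fix X assume "X \<in> Q b \<and> z \<in> region X"
      then have "half c b \<odot> X \<in> P" "emb (half c b) z \<in> region (half c b \<odot> X)" by (auto simp: Q_def)
      then have "half c b \<odot> X = R" using R P partition_disjoint by blast
      then show "X = Z" using Z \<open>b' = b\<close> by (simp add: dmul_left_cancel)
    qed
  qed
  moreover have "P = (\<odot>) (half c False) ` Q False \<union> (\<odot>) (half c True) ` Q True"
  proof (intro equalityI subsetI)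
    fix R assume R: "R \<in> P"
    then obtain b Z where "valid Z" "R = half c b \<odot> Z"
      using P c by (meson half_factor partition_valid)
    then show "R \<in> (\<odot>) (half c False) ` Q False \<union> (\<odot>) (half c True) ` Q True"
      using R by (cases b) (auto simp: Q_def)
  qed (auto simp: Q_def)
  ultimately show ?thesis using that by blast
qed

lemma partition_tree:
  assumes "dyadic_partition P"
  obtains T where "leaves T = P"
proof -
  have "\<exists>T. leaves T = P" using assms
  proof (induction "card P" arbitrary: P rule: less_induct)
    case less
    show ?case
    proof (cases "root \<in> P")
      case True
      have "P \<subseteq> {root}"
      proof
        fix R assume "R \<in> P"
        then have "region R \<inter> region root \<noteq> {}"
          using less.prems region_nonempty region_root valid_emb partition_valid by blast
        then show "R \<in> {root}" using partition_disjoint' less.prems \<open>R \<in> P\<close> True by blast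
      qed
      then show ?thesis using True by (intro exI[of _ Leaf]) (auto simp: leaves_Leaf)
    next
      case False
      then obtain c where c: "\<And>R. R \<in> P \<Longrightarrow> depth c R > 0" using less.prems guillotine_cut by blast
      obtain P0 P1 where P: "dyadic_partition P0" "dyadic_partition P1"
        "P = (\<odot>) (half c False) ` P0 \<union> (\<odot>) (half c True) ` P1"
        using partition_unjoin[OF less.prems c] by blast
      have "card P = card P0 + card P1" unfolding P(3) using P by (intro partition_join)
      then have "card P0 < card P" "card P1 < card P" using P partition_card_pos by auto
      then obtain T0 T1 where "leaves T0 = P0" "leaves T1 = P1" using less.hyps P by metis
      then show ?thesis using P by (intro exI[of _ "Caret c T0 T1"]) (simp add: leaves_Caret)
    qed
  qed
  then show ?thesis using that by blast
qed

section \<open>Elements of 2V as maps carrying a partition to a partition\<close>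

lemma partition_image:
  assumes P: "dyadic_partition P"
    and f: "bij_betw f unit_square unit_square"
    and c: "\<And>R z. R \<in> P \<Longrightarrow> z \<in> unit_square \<Longrightarrow> f (emb R z) = emb (\<phi> R) z"
  shows "inj_on \<phi> P" "dyadic_partition (\<phi> ` P)"
proof -
  have img: "f ` region R = region (\<phi> R)" if "R \<in> P" for R
    using c[OF that] by (auto simp: region_emb image_image)
  have pre: "z \<in> region R" if "R \<in> P" "f z \<in> region (\<phi> R)" "z \<in> unit_square" for R z
  proof -
    have "f z \<in> f ` region R" using that img by simp
    then obtain y where y: "y \<in> region R" "f z = f y" by blast
    have "y \<in> unit_square" using y(1) that(1) P partition_valid valid_emb by blast
    then have "z = y" using f y(2) that(3) by (auto simp: bij_betw_def inj_on_def)
    then show ?thesis using y(1) by simp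
  qed
  show inj: "inj_on \<phi> P"
  proof (rule inj_onI)
    fix R R' assume R: "R \<in> P" "R' \<in> P" "\<phi> R = \<phi> R'"
    have "emb R (1,1) \<in> unit_square" using R P partition_valid emb_in_square by simp
    moreover have "f (emb R (1,1)) \<in> region (\<phi> R')" using c[OF R(1)] R(3) by simp
    ultimately have "emb R (1,1) \<in> region R'" using pre R by blast
    then show "R = R'" using P R partition_disjoint by (metis emb_in_region one_one_in_square)
  qed
  show "dyadic_partition (\<phi> ` P)" unfolding dyadic_partition_def
  proof (intro conjI ballI)
    show "finite (\<phi> ` P)" using P partition_finite by blast
    show "valid X" if X: "X \<in> \<phi> ` P" for X
    proof -
      obtain R where R: "R \<in> P" "X = \<phi> R" using X by blast
      have "region X \<subseteq> f ` unit_square"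
        using img[OF R(1)] R partition_valid[OF P R(1)] valid_emb by blast
      then show ?thesis using f by (simp add: valid_emb bij_betw_def)
    qed
    fix z assume "z \<in> unit_square"
    then obtain y where y: "y \<in> unit_square" "z = f y" using f unfolding bij_betw_def by blast
    obtain R where R: "R \<in> P" "y \<in> region R" using P y(1) by (rule partition_cell)
    show "\<exists>!X. X \<in> \<phi> ` P \<and> z \<in> region X"
    proof (rule ex1I[of _ "\<phi> R"])
      show "\<phi> R \<in> \<phi> ` P \<and> z \<in> region (\<phi> R)" using R y img by blast
      fix X assume "X \<in> \<phi> ` P \<and> z \<in> region X"
      then obtain R' where R': "R' \<in> P" "X = \<phi> R'" "z \<in> region (\<phi> R')" by auto
      then have "y \<in> region R'" using pre y by blast
      then show "X = \<phi> R" using R R' P partition_disjoint by blast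
    qed
  qed
qed

definition carries :: "(real \<times> real \<Rightarrow> real \<times> real) \<Rightarrow> drect \<Rightarrow> drect \<Rightarrow> bool" where
  "carries f R R' \<longleftrightarrow> (\<forall>z\<in>unit_square. f (emb R z) = emb R' z)"

lemma carries_mul: "carries f R R' \<Longrightarrow> valid Q \<Longrightarrow> carries f (R \<odot> Q) (R' \<odot> Q)"
  by (simp add: carries_def emb_dmul emb_in_square)

lemma carries_unique: "carries f R R' \<Longrightarrow> carries f R R'' \<Longrightarrow> R' = R''"
  by (rule emb_determines) (auto simp: carries_def)

lemma carries_image: "carries f R R' \<Longrightarrow> f ` region R = region R'"
  unfolding region_emb carries_def image_image by (rule image_cong) auto

lemma affine_Ioc:
  fixes a b p q p' q' :: real
  assumes "a > 0" "p < q" "p' < q'" "(\<lambda>x. a * x + b) ` {p<..q} = {p'<..q'}"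
  shows "a * p + b = p'" "a * q + b = q'"
proof -
  have "(\<lambda>x. a * x + b) ` {p<..q} = {a * p + b<..a * q + b}"
  proof (intro equalityI subsetI)
    fix y assume y: "y \<in> {a * p + b<..a * q + b}"
    then have "y = a * ((y - b) / a) + b" "(y - b) / a \<in> {p<..q}"
      using assms(1) by (auto simp: field_simps)
    then show "y \<in> (\<lambda>x. a * x + b) ` {p<..q}" by blast
  qed (use assms(1) in auto)
  moreover have "a * p + b < a * q + b" using assms by simp
  ultimately show "a * p + b = p'" "a * q + b = q'"
    using assms by (auto simp: Ioc_inj)
qed

text \<open>An increasing affine map between two intervals is determined by its endpoints, so the
  existentially quantified coefficients of a diagram's map are forced.\<close>
lemma maps_affinely_carries: "maps_affinely f (region R) (region R') \<longleftrightarrow> carries f R R'"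
proof (cases R; cases R')
  fix i r j s i' r' j' s'
  assume R: "R = DRect i r j s" "R' = DRect i' r' j' s'"
  show ?thesis
  proof
    assume c: "carries f R R'"
    show "maps_affinely f (region R) (region R')" unfolding maps_affinely_def
    proof (intro conjI exI)
      show "f ` region R = region R'" using c by (rule carries_image)
      show "(2::real) ^ r / 2 ^ r' > 0" "(2::real) ^ s / 2 ^ s' > 0" by simp_all
      show "\<forall>(u, v)\<in>region R. f (u, v) = (2 ^ r / 2 ^ r' * u + (real i' - real i) / 2 ^ r',
          2 ^ s / 2 ^ s' * v + (real j' - real j) / 2 ^ s')"
      proof (intro ballI, clarify)
        fix u v assume "(u, v) \<in> region R"
        then obtain z where z: "z \<in> unit_square" "(u, v) = emb R z" by (auto simp: region_emb)
        then have "f (u, v) = emb R' z" using c by (simp add: carries_def)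
        then show "f (u, v) = (2 ^ r / 2 ^ r' * u + (real i' - real i) / 2 ^ r',
          2 ^ s / 2 ^ s' * v + (real j' - real j) / 2 ^ s')"
          using z(2) by (simp add: R flip: add_divide_distrib)
      qed
    qed
  next
    assume "maps_affinely f (region R) (region R')"
    then obtain a b c d where f: "f ` region R = region R'" "a > 0" "c > 0"
      "\<forall>(u, v)\<in>region R. f (u, v) = (a * u + b, c * v + d)"
      by (auto simp: maps_affinely_def)
    let ?I = "\<lambda>i r. {real i / 2 ^ r <.. (real i + 1) / 2 ^ r}"
    have lt: "real i / 2 ^ r < (real i + 1) / 2 ^ r" for i r :: nat
      by (simp add: divide_strict_right_mono)
    then have ne: "?I i r \<noteq> {}" for i r by simp
    have "f ` region R = (\<lambda>(u, v). (a * u + b, c * v + d)) ` region R"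
      using f(4) by (intro image_cong) auto
    also have "\<dots> = (\<lambda>u. a * u + b) ` ?I i r \<times> (\<lambda>v. c * v + d) ` ?I j s"
      unfolding R region.simps by (rule image_paired_Times)
    finally have "(\<lambda>u. a * u + b) ` ?I i r \<times> (\<lambda>v. c * v + d) ` ?I j s = ?I i' r' \<times> ?I j' s'"
      using f(1) by (simp add: R)
    then have "(\<lambda>u. a * u + b) ` ?I i r = ?I i' r'" "(\<lambda>v. c * v + d) ` ?I j s = ?I j' s'"
      using ne by (auto simp only: times_eq_iff image_is_empty)
    note 1 = affine_Ioc[OF f(2) lt lt this(1)] and 2 = affine_Ioc[OF f(3) lt lt this(2)]
    have ev: "a * ((real i + u) / 2 ^ r) + b = (real i' + u) / 2 ^ r'"
      if "a * (real i / 2 ^ r) + b = real i' / 2 ^ r'" "a * ((real i + 1) / 2 ^ r) + b = (real i' + 1) / 2 ^ r'"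
      for a b u :: real and i r i' r' :: nat
    proof -
      have "a / 2 ^ r = a * ((real i + 1) / 2 ^ r) - a * (real i / 2 ^ r)"
        by (simp add: add_divide_distrib distrib_left)
      also have "\<dots> = (real i' + 1) / 2 ^ r' - real i' / 2 ^ r'" using that by linarith
      also have "\<dots> = 1 / 2 ^ r'" by (simp add: add_divide_distrib)
      finally have "a / 2 ^ r = 1 / 2 ^ r'" .
      have "a * u / 2 ^ r = (a / 2 ^ r) * u" by simp
      also have "\<dots> = u / 2 ^ r'" by (simp only: \<open>a / 2 ^ r = 1 / 2 ^ r'\<close>) simp
      finally have "a * u / 2 ^ r = u / 2 ^ r'" .
      then show ?thesis using that(1) by (simp add: add_divide_distrib distrib_left)
    qed
    show "carries f R R'" unfolding carries_def
    proof
      fix z assume z: "z \<in> unit_square"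
      obtain u v where uv: "z = (u, v)" by (cases z)
      have "emb R z \<in> region R" using z by simp
      then have "f (emb R z) = (a * fst (emb R z) + b, c * snd (emb R z) + d)"
        using f(4) by (auto simp: case_prod_beta)
      then show "f (emb R z) = emb R' z"
        using ev[OF 1] ev[OF 2] by (simp add: R uv)
    qed
  qed
qed

text \<open>The set \<open>P\<close> plays the role of the leaves of the domain tree of a diagram for \<open>f\<close>.\<close>
definition pieces :: "drect set \<Rightarrow> (real \<times> real \<Rightarrow> real \<times> real) \<Rightarrow> bool" where
  "pieces P f \<longleftrightarrow> f \<in> Bij unit_square \<and> dyadic_partition P \<and> (\<forall>R\<in>P. \<exists>R'. carries f R R')"

lemma pieces_image:
  assumes "pieces P f"
  obtains \<phi> where "\<And>R. R \<in> P \<Longrightarrow> carries f R (\<phi> R)" "inj_on \<phi> P" "dyadic_partition (\<phi> ` P)"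
proof -
  have "\<exists>\<phi>. \<forall>R\<in>P. carries f R (\<phi> R)" using assms unfolding pieces_def by (intro bchoice) auto
  then obtain \<phi> where \<phi>: "\<forall>R\<in>P. carries f R (\<phi> R)" by blast
  have "bij_betw f unit_square unit_square" using assms by (simp add: pieces_def Bij_def)
  then show ?thesis
    using that[of \<phi>] \<phi> partition_image[of P f \<phi>] assms by (auto simp: carries_def pieces_def)
qed

lemma leaf_region_nth: "leaf_region T i = region (subdivide T root ! i)"
  by (simp add: leaf_region_def)

text \<open>The images of the cells again form a partition, which has a tree of its own; matching the two leaf lists
  yields the permutation of a diagram.\<close>
lemma diagram_iff_pieces:
  "(\<exists>D. tree_pair_diagram D \<and> represents D f \<and> diagram_carets D = n) \<longleftrightarrow>
   (\<exists>P. pieces P f \<and> card P = Suc n)"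
proof
  assume "\<exists>D. tree_pair_diagram D \<and> represents D f \<and> diagram_carets D = n"
  then obtain T p T' where D: "tree_pair_diagram (T, p, T')" "represents (T, p, T') f" "carets T = n"
    by (metis diagram_carets.simps prod_cases3)
  have "\<exists>R'. carries f R R'" if R: "R \<in> leaves T" for R
  proof -
    obtain i where i: "i < num_leaves T" "R = subdivide T root ! i"
      using R unfolding leaves_def in_set_conv_nth length_subdivide by blast
    then show ?thesis using D(2) by (auto simp: leaf_region_nth maps_affinely_carries)
  qed
  then have "pieces (leaves T) f" using D(2) leaves_partition by (auto simp: pieces_def)
  moreover have "card (leaves T) = Suc n" using D(3) by (simp add: leaves_partition num_leaves_eq)
  ultimately show "\<exists>P. pieces P f \<and> card P = Suc n" by blast
next
  assume "\<exists>P. pieces P f \<and> card P = Suc n"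
  then obtain P where P: "pieces P f" "card P = Suc n" by blast
  obtain \<phi> where \<phi>: "\<And>R. R \<in> P \<Longrightarrow> carries f R (\<phi> R)" "inj_on \<phi> P" "dyadic_partition (\<phi> ` P)"
    using P(1) by (rule pieces_image) blast
  obtain T where T: "leaves T = P" using P(1) partition_tree by (auto simp: pieces_def)
  obtain T' where T': "leaves T' = \<phi> ` P" using \<phi>(3) partition_tree by blast
  let ?xs = "subdivide T root" and ?ys = "subdivide T' root"
  have n: "num_leaves T = num_leaves T'"
    using T T' \<phi>(2) by (metis card_image leaves_partition(2))
  have "mset (map \<phi> ?xs) = mset ?ys"
  proof (subst set_eq_iff_mset_eq_distinct[symmetric])
    show "distinct (map \<phi> ?xs)" using \<phi>(2) T by (simp add: distinct_map distinct_subdivide leaves_def)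
    show "set (map \<phi> ?xs) = set ?ys" using T T' by (simp add: leaves_def)
  qed (rule distinct_subdivide)
  then obtain p where p: "p permutes {..<length ?ys}" "permute_list p ?ys = map \<phi> ?xs"
    by (rule mset_eq_permutation)
  have "represents (T, p, T') f"
  proof (simp, intro conjI allI impI)
    show "f \<in> Bij unit_square" using P(1) by (simp add: pieces_def)
    fix i assume i: "i < num_leaves T"
    then have "?ys ! p i = \<phi> (?xs ! i)"
      using p n by (metis length_subdivide nth_map permute_list_nth)
    moreover have "?xs ! i \<in> P" using i T by (auto simp: leaves_def length_subdivide)
    ultimately show "maps_affinely f (leaf_region T i) (leaf_region T' (p i))"
      using \<phi>(1) by (simp add: leaf_region_nth maps_affinely_carries)
  qed
  moreover have "tree_pair_diagram (T, p, T')" using p(1) n by (simp add: length_subdivide)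
  moreover have "carets T = n" using P(2) T leaves_partition(2)[of T] by (simp add: num_leaves_eq)
  ultimately show "\<exists>D. tree_pair_diagram D \<and> represents D f \<and> diagram_carets D = n"
    by (intro exI[of _ "(T, p, T')"]) (auto simp: n)
qed

lemma carrier_iff_pieces: "f \<in> carrier Brin_2V \<longleftrightarrow> (\<exists>P. pieces P f)"
proof
  assume "f \<in> carrier Brin_2V"
  then obtain D where "tree_pair_diagram D" "represents D f" unfolding Brin_2V_def by force
  then show "\<exists>P. pieces P f" using diagram_iff_pieces[of f "diagram_carets D"] by blast
next
  assume "\<exists>P. pieces P f"
  then obtain P where P: "pieces P f" by blast
  then have "card P = Suc (card P - 1)" using partition_card_pos by (auto simp: pieces_def)
  then show "f \<in> carrier Brin_2V" using P diagram_iff_pieces[of f "card P - 1"] by (auto simp: Brin_2V_def)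
qed

lemma min_carets_le: "pieces P f \<Longrightarrow> Suc (min_carets f) \<le> card P"
proof -
  assume P: "pieces P f"
  then have "card P = Suc (card P - 1)" using partition_card_pos by (auto simp: pieces_def)
  then have "min_carets f \<le> card P - 1"
    unfolding min_carets_def diagram_iff_pieces using P by (intro Least_le) metis
  then show ?thesis using \<open>card P = Suc (card P - 1)\<close> by linarith
qed

lemma min_carets_attained:
  assumes "f \<in> carrier Brin_2V"
  obtains P where "pieces P f" "card P = Suc (min_carets f)"
proof -
  obtain Q where Q: "pieces Q f" using assms by (auto simp: carrier_iff_pieces)
  then have "card Q = Suc (card Q - 1)" using partition_card_pos by (auto simp: pieces_def)
  then have "\<exists>n. \<exists>P. pieces P f \<and> card P = Suc n" using Q by blast
  then have "\<exists>P. pieces P f \<and> card P = Suc (min_carets f)"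
    unfolding min_carets_def diagram_iff_pieces by (rule LeastI_ex)
  then show ?thesis using that by blast
qed

section \<open>The group structure and caret growth\<close>

lemma Bij_mult: "f \<in> Bij S \<Longrightarrow> g \<in> Bij S \<Longrightarrow> f \<otimes>\<^bsub>BijGroup S\<^esub> g = compose S f g"
  by (simp add: BijGroup_def)

lemma Bij_in: "f \<in> Bij S \<Longrightarrow> x \<in> S \<Longrightarrow> f x \<in> S"
  using Bij_imp_funcset by auto

lemma pieces_one: "pieces {root} (\<one>\<^bsub>BijGroup unit_square\<^esub>)"
  using group.subgroup_self[OF group_BijGroup[of unit_square]]
    monoid.one_closed[OF group.is_monoid[OF group_BijGroup[of unit_square]]]
  by (auto simp: pieces_def partition_root carries_def BijGroup_def intro!: exI[of _ root])

lemma carries_inverse: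
  assumes f: "f \<in> Bij unit_square" and c: "carries f R R'" and R: "valid R"
  shows "carries (restrict (inv_into unit_square f) unit_square) R' R"
  unfolding carries_def
proof
  fix z assume z: "z \<in> unit_square"
  have e: "emb R z \<in> unit_square" "f (emb R z) = emb R' z"
    using emb_in_square R z c by (auto simp: carries_def)
  then have "emb R' z \<in> unit_square" using f Bij_in by metis
  moreover have "inv_into unit_square f (emb R' z) = emb R z"
    using e f by (metis Bij_def bij_betw_def inv_into_f_f IntD2 mem_Collect_eq)
  ultimately show "restrict (inv_into unit_square f) unit_square (emb R' z) = emb R z" by simp
qed

lemma pieces_inverse:
  assumes P: "pieces P f"
  obtains P' where "pieces P' (restrict (inv_into unit_square f) unit_square)" "card P' = card P"
    "\<And>R'. R' \<in> P' \<Longrightarrow> \<exists>R. valid R \<and> carries f R R'"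
proof -
  obtain \<phi> where \<phi>: "\<And>R. R \<in> P \<Longrightarrow> carries f R (\<phi> R)" "inj_on \<phi> P" "dyadic_partition (\<phi> ` P)"
    using P by (rule pieces_image) blast
  have f: "f \<in> Bij unit_square" and v: "\<And>R. R \<in> P \<Longrightarrow> valid R"
    using P partition_valid by (auto simp: pieces_def)
  show ?thesis
  proof (rule that[of "\<phi> ` P"])
    show "pieces (\<phi> ` P) (restrict (inv_into unit_square f) unit_square)"
      using restrict_inv_into_Bij[OF f] \<phi>(1,3) carries_inverse[OF f] v unfolding pieces_def by blast
    show "card (\<phi> ` P) = card P" using \<phi>(2) by (rule card_image)
  qed (use \<phi> v in blast)
qed

lemma carries_compose:
  assumes "f \<in> Bij unit_square" "carries f R R'" "carries g R' R''" "valid R"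
  shows "carries (compose unit_square g f) R R''"
  using assms emb_in_square by (auto simp: carries_def compose_def)

text \<open>The cells of the range of \<open>f\<close> are refined together with \<open>Q\<close>, and the refinement is pulled back by
  \<open>f\<close>. The pulled back cells form a partition because they are the images of a partition under the
  inverse of \<open>f\<close>.\<close>
lemma pieces_compose:
  assumes P: "pieces P f" and Q: "pieces Q g"
  obtains I where "pieces I (compose unit_square g f)" "card I \<le> card P * card Q"
proof -
  let ?h = "restrict (inv_into unit_square f) unit_square"
  obtain \<phi> where \<phi>: "\<And>R. R \<in> P \<Longrightarrow> carries f R (\<phi> R)" "inj_on \<phi> P" "dyadic_partition (\<phi> ` P)"
    using P by (rule pieces_image) blast
  obtain I where I: "dyadic_partition I" "card I \<le> card (\<phi> ` P) * card Q"
    "\<And>X. X \<in> I \<Longrightarrow> \<exists>R\<in>\<phi> ` P. \<exists>Z. valid Z \<and> X = R \<odot> Z"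
    "\<And>X. X \<in> I \<Longrightarrow> \<exists>R\<in>Q. \<exists>Z. valid Z \<and> X = R \<odot> Z"
    using common_refinement[OF \<phi>(3), of Q] Q by (auto simp: pieces_def)
  have f: "f \<in> Bij unit_square" and g: "g \<in> Bij unit_square" using P Q by (auto simp: pieces_def)
  have ex: "\<exists>Y. valid Y \<and> carries f Y X" if X: "X \<in> I" for X
  proof -
    obtain R Z where "R \<in> P" "valid Z" "X = \<phi> R \<odot> Z" using I(3)[OF X] by blast
    then show ?thesis
      using \<phi>(1) P partition_valid by (intro exI[of _ "R \<odot> Z"]) (auto simp: carries_mul valid_mul pieces_def)
  qed
  have "pieces I ?h"
    using I(1) restrict_inv_into_Bij[OF f] ex carries_inverse[OF f] unfolding pieces_def by blast
  then obtain \<psi> where \<psi>: "\<And>X. X \<in> I \<Longrightarrow> carries ?h X (\<psi> X)" "inj_on \<psi> I" "dyadic_partition (\<psi> ` I)"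
    by (rule pieces_image) blast
  show ?thesis
  proof (rule that[of "\<psi> ` I"])
    show "card (\<psi> ` I) \<le> card P * card Q" using \<psi>(2) I(2) \<phi>(2) by (simp add: card_image)
    have "\<exists>Y. carries (compose unit_square g f) (\<psi> X) Y" if X: "X \<in> I" for X
    proof -
      obtain R where R: "valid R" "carries f R X" using ex[OF X] by blast
      then have "carries ?h X R" using carries_inverse f by blast
      then have "\<psi> X = R" using \<psi>(1)[OF X] carries_unique by blast
      obtain R1 Z where Z: "R1 \<in> Q" "valid Z" "X = R1 \<odot> Z" using I(4)[OF X] by blast
      then obtain R2 where "carries g R1 R2" using Q by (auto simp: pieces_def)
      then have "carries g X (R2 \<odot> Z)" using Z carries_mul by simp
      then show ?thesis using carries_compose[OF f R(2) _ R(1)] \<open>\<psi> X = R\<close> by blast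
    qed
    then show "pieces (\<psi> ` I) (compose unit_square g f)"
      using \<psi>(3) f g by (auto simp: pieces_def compose_Bij)
  qed
qed

lemma Brin_2V_subgroup: "subgroup (carrier Brin_2V) (BijGroup unit_square)"
proof (rule group.subgroupI[OF group_BijGroup])
  show "carrier Brin_2V \<subseteq> carrier (BijGroup unit_square)"
    by (auto simp: carrier_iff_pieces pieces_def BijGroup_def)
  show "carrier Brin_2V \<noteq> {}" using pieces_one carrier_iff_pieces by blast
  show "inv\<^bsub>BijGroup unit_square\<^esub> a \<in> carrier Brin_2V" if "a \<in> carrier Brin_2V" for a
  proof -
    obtain P where P: "pieces P a" using \<open>a \<in> carrier Brin_2V\<close> carrier_iff_pieces by blast
    then have "inv\<^bsub>BijGroup unit_square\<^esub> a = restrict (inv_into unit_square a) unit_square"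
      by (intro inv_BijGroup) (simp add: pieces_def)
    then show ?thesis using pieces_inverse[OF P] carrier_iff_pieces by metis
  qed
  show "a \<otimes>\<^bsub>BijGroup unit_square\<^esub> b \<in> carrier Brin_2V"
    if "a \<in> carrier Brin_2V" "b \<in> carrier Brin_2V" for a b
  proof -
    obtain P Q where PQ: "pieces P a" "pieces Q b"
      using \<open>a \<in> carrier Brin_2V\<close> \<open>b \<in> carrier Brin_2V\<close> unfolding carrier_iff_pieces by blast
    then have "a \<otimes>\<^bsub>BijGroup unit_square\<^esub> b = compose unit_square a b"
      by (intro Bij_mult) (auto simp: pieces_def)
    then show ?thesis using pieces_compose[OF PQ(2,1)] carrier_iff_pieces by metis
  qed
qed

lemma Brin_2V_eq: "Brin_2V = (BijGroup unit_square)\<lparr>carrier := carrier Brin_2V\<rparr>"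
  by (simp add: Brin_2V_def)

lemma Brin_2V_group: "group Brin_2V"
  by (subst Brin_2V_eq) (rule subgroup.subgroup_is_group[OF Brin_2V_subgroup group_BijGroup])

lemma carrier_Bij: "f \<in> carrier Brin_2V \<Longrightarrow> f \<in> Bij unit_square"
  by (auto simp: carrier_iff_pieces pieces_def)

lemma Brin_2V_mult:
  "f \<in> carrier Brin_2V \<Longrightarrow> g \<in> carrier Brin_2V \<Longrightarrow> f \<otimes>\<^bsub>Brin_2V\<^esub> g = compose unit_square f g"
  by (subst Brin_2V_eq) (simp add: Bij_mult carrier_Bij)

lemma Brin_2V_one: "\<one>\<^bsub>Brin_2V\<^esub> = (\<lambda>x\<in>unit_square. x)"
  by (subst Brin_2V_eq) (simp add: BijGroup_def)

lemma Brin_2V_inv: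
  assumes "f \<in> carrier Brin_2V"
  shows "inv\<^bsub>Brin_2V\<^esub> f = restrict (inv_into unit_square f) unit_square"
proof -
  have "inv\<^bsub>Brin_2V\<^esub> f = inv\<^bsub>BijGroup unit_square\<^esub> f"
    by (subst Brin_2V_eq) (rule group.m_inv_consistent[OF group_BijGroup Brin_2V_subgroup assms])
  then show ?thesis using inv_BijGroup carrier_Bij[OF assms] by simp
qed

lemma mult_apply:
  "f \<in> carrier Brin_2V \<Longrightarrow> g \<in> carrier Brin_2V \<Longrightarrow> z \<in> unit_square \<Longrightarrow>
    (f \<otimes>\<^bsub>Brin_2V\<^esub> g) z = f (g z)"
  by (simp add: Brin_2V_mult compose_def)

lemma carries_mult:
  assumes "f \<in> carrier Brin_2V" "g \<in> carrier Brin_2V" "carries g R R'" "carries f R' R''" "valid R"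
  shows "carries (f \<otimes>\<^bsub>Brin_2V\<^esub> g) R R''"
  using assms carries_compose carrier_Bij by (simp add: Brin_2V_mult)

lemma carries_inv:
  assumes "f \<in> carrier Brin_2V" "carries f R R'" "valid R"
  shows "carries (inv\<^bsub>Brin_2V\<^esub> f) R' R"
  using assms carries_inverse carrier_Bij by (simp add: Brin_2V_inv)

lemma carrier_eqI:
  assumes "f \<in> carrier Brin_2V" "g \<in> carrier Brin_2V" "dyadic_partition P"
    "\<And>R. R \<in> P \<Longrightarrow> \<exists>R'. carries f R R' \<and> carries g R R'"
  shows "f = g"
proof (rule extensionalityI[of _ unit_square])
  show "f \<in> extensional unit_square" "g \<in> extensional unit_square"
    using assms(1,2) carrier_Bij by (auto simp: Bij_def)
  fix z assume "z \<in> unit_square"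
  then obtain R where R: "R \<in> P" "z \<in> region R" using assms(3) partition_cell by blast
  then obtain y where "y \<in> unit_square" "z = emb R y" by (auto simp: region_emb)
  then show "f z = g z" using assms(4)[OF R(1)] by (auto simp: carries_def)
qed

lemma min_carets_mult:
  assumes "f \<in> carrier Brin_2V" "g \<in> carrier Brin_2V"
  shows "Suc (min_carets (f \<otimes>\<^bsub>Brin_2V\<^esub> g)) \<le> Suc (min_carets f) * Suc (min_carets g)"
proof -
  obtain P where P: "pieces P f" "card P = Suc (min_carets f)" using assms(1) min_carets_attained by blast
  obtain Q where Q: "pieces Q g" "card Q = Suc (min_carets g)" using assms(2) min_carets_attained by blast
  obtain I where I: "pieces I (compose unit_square f g)" "card I \<le> card Q * card P"
    using pieces_compose[OF Q(1) P(1)] by blast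
  have "Suc (min_carets (f \<otimes>\<^bsub>Brin_2V\<^esub> g)) \<le> card I"
    using min_carets_le[OF I(1)] assms by (simp add: Brin_2V_mult)
  then show ?thesis using I(2) P(2) Q(2) by (metis le_trans mult.commute)
qed

lemma min_carets_one: "min_carets (\<one>\<^bsub>Brin_2V\<^esub>) = 0"
  using min_carets_le[of "{root}" "\<one>\<^bsub>Brin_2V\<^esub>"] pieces_one by (simp add: Brin_2V_one BijGroup_def)

text \<open>The only partition with a single cell is the trivial one.\<close>
lemma min_carets_pos:
  assumes "f \<in> carrier Brin_2V" "f \<noteq> \<one>\<^bsub>Brin_2V\<^esub>"
  shows "min_carets f > 0"
proof (rule ccontr)
  assume "\<not> min_carets f > 0"
  then obtain P where P: "pieces P f" "card P = 1" using min_carets_attained[OF assms(1)] by auto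
  obtain \<phi> where \<phi>: "\<And>R. R \<in> P \<Longrightarrow> carries f R (\<phi> R)" "inj_on \<phi> P" "dyadic_partition (\<phi> ` P)"
    using P(1) by (rule pieces_image) blast
  have single: "R = root" if "dyadic_partition {R}" for R
  proof -
    obtain T where T: "leaves T = {R}" using \<open>dyadic_partition {R}\<close> partition_tree by blast
    then have "num_leaves T = 1" using leaves_partition(2)[of T] by simp
    then have "T = Leaf" by (cases T) (auto simp: num_leaves_eq)
    then show ?thesis using T by (simp add: leaves_Leaf)
  qed
  obtain R where R: "P = {R}" using P(2) by (auto simp: card_1_singleton_iff)
  have "R = root" using single P(1) R by (simp add: pieces_def)
  moreover have "\<phi> R = root" using single \<phi>(3) R by simp
  ultimately have "carries f root root" using \<phi>(1)[of R] R by simp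
  moreover have "carries (\<one>\<^bsub>Brin_2V\<^esub>) root root" by (simp add: carries_def Brin_2V_one)
  ultimately have "f = \<one>\<^bsub>Brin_2V\<^esub>"
    using carrier_eqI[OF assms(1) _ partition_root] group.is_monoid[OF Brin_2V_group] monoid.one_closed by blast
  then show False using assms(2) by simp
qed

section \<open>Gluing affine pieces\<close>

definition glue :: "drect set \<Rightarrow> (drect \<Rightarrow> drect) \<Rightarrow> real \<times> real \<Rightarrow> real \<times> real" where
  "glue P \<phi> = (\<lambda>z\<in>unit_square. let R = THE R. R \<in> P \<and> z \<in> region R in emb (\<phi> R) (inv_into unit_square (emb R) z))"

lemma glue_carries:
  assumes "dyadic_partition P" "R \<in> P"
  shows "carries (glue P \<phi>) R (\<phi> R)"
  unfolding carries_def
proof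
  fix z assume z: "z \<in> unit_square"
  have "(THE R. R \<in> P \<and> emb R' z \<in> region R) = R'" if "R' \<in> P" for R'
    using assms(1) that z partition_disjoint by (intro the_equality) (simp, blast intro: emb_in_region[THEN iffD2])
  moreover have "inv_into unit_square (emb R) (emb R z) = z"
    using z by (intro inv_into_f_f) (auto simp: inj_on_def emb_inj)
  ultimately show "glue P \<phi> (emb R z) = emb (\<phi> R) z"
    using assms z emb_in_square partition_valid by (simp add: glue_def)
qed

lemma glue_pieces:
  assumes P: "dyadic_partition P" and Q: "dyadic_partition Q" and \<phi>: "bij_betw \<phi> P Q"
  shows "pieces P (glue P \<phi>)"
proof -
  let ?f = "glue P \<phi>"
  have "bij_betw ?f unit_square unit_square"
  proof (rule bij_betw_byWitness[where f' = "glue Q (inv_into P \<phi>)"])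
    have \<psi>: "inv_into P \<phi> (\<phi> R) = R" "\<phi> R \<in> Q" if "R \<in> P" for R
      using \<phi> that by (auto simp: bij_betw_def)
    have \<psi>': "\<phi> (inv_into P \<phi> R) = R" "inv_into P \<phi> R \<in> P" if "R \<in> Q" for R
      using \<phi> that by (auto simp: bij_betw_def f_inv_into_f inv_into_into)
    have 1: "\<exists>R y. R \<in> P \<and> y \<in> unit_square \<and> z = emb R y" if "z \<in> unit_square" for z
      using partition_cell[OF P that] unfolding region_emb by blast
    have 2: "\<exists>R y. R \<in> Q \<and> y \<in> unit_square \<and> z = emb R y" if "z \<in> unit_square" for z
      using partition_cell[OF Q that] unfolding region_emb by blast
    note c = glue_carries[OF P, unfolded carries_def, rule_format]
      and c' = glue_carries[OF Q, unfolded carries_def, rule_format]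
    show "\<forall>z\<in>unit_square. glue Q (inv_into P \<phi>) (?f z) = z"
      using 1 by (fastforce simp: c c' \<psi>)
    show "\<forall>z\<in>unit_square. ?f (glue Q (inv_into P \<phi>) z) = z"
      using 2 by (fastforce simp: c c' \<psi>')
    show "?f ` unit_square \<subseteq> unit_square"
      using 1 by (fastforce simp: c \<psi> emb_in_square partition_valid[OF Q])
    show "glue Q (inv_into P \<phi>) ` unit_square \<subseteq> unit_square"
      using 2 by (fastforce simp: c' \<psi>' emb_in_square partition_valid[OF P])
  qed
  moreover have "?f \<in> extensional unit_square" by (simp add: glue_def)
  ultimately show ?thesis using P glue_carries[OF P] by (auto simp: pieces_def Bij_def)
qed

lemma glue_exists:
  assumes "dyadic_partition P" "dyadic_partition Q" "bij_betw \<phi> P Q"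
  obtains f where "f \<in> carrier Brin_2V" "pieces P f" "\<And>R. R \<in> P \<Longrightarrow> carries f R (\<phi> R)"
  using glue_pieces[OF assms] glue_carries[OF assms(1)] carrier_iff_pieces by blast

section \<open>Word length\<close>

definition symmetrized :: "('a, 'b) monoid_scheme \<Rightarrow> 'a set \<Rightarrow> 'a set" where
  "symmetrized G S = S \<union> (\<lambda>s. inv\<^bsub>G\<^esub> s) ` S"

locale finitely_generated_group = group G for G (structure) +
  fixes S
  assumes finite_generators: "finite S"
    and generators_closed: "S \<subseteq> carrier G"
    and generates: "generate G S = carrier G"
begin

abbreviation evaluate :: "'a list \<Rightarrow> 'a" where
  "evaluate ws \<equiv> foldr (\<otimes>) ws \<one>"

abbreviation wl :: "'a \<Rightarrow> nat" where
  "wl \<equiv> word_length G S"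

lemma symmetrized_closed: "symmetrized G S \<subseteq> carrier G"
  using generators_closed by (auto simp: symmetrized_def)

lemma finite_symmetrized: "finite (symmetrized G S)"
  using finite_generators by (simp add: symmetrized_def)

lemma inv_symmetrized: "s \<in> symmetrized G S \<Longrightarrow> inv s \<in> symmetrized G S"
  using generators_closed by (auto simp: symmetrized_def)

lemma evaluate_closed: "set ws \<subseteq> carrier G \<Longrightarrow> evaluate ws \<in> carrier G"
  by (induction ws) auto

lemma evaluate_append:
  "set us \<subseteq> carrier G \<Longrightarrow> set vs \<subseteq> carrier G \<Longrightarrow>
    evaluate (us @ vs) = evaluate us \<otimes> evaluate vs"
  by (induction us) (auto simp: evaluate_closed m_assoc)

lemma evaluate_inverse:
  "set ws \<subseteq> carrier G \<Longrightarrow> evaluate (rev (map (m_inv G) ws)) = inv (evaluate ws)"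
proof (induction ws)
  case (Cons w ws)
  have "evaluate (rev (map (m_inv G) ws) @ [inv w]) =
      evaluate (rev (map (m_inv G) ws)) \<otimes> evaluate [inv w]"
    using Cons.prems by (intro evaluate_append) auto
  then have "evaluate (rev (map (m_inv G) (w # ws))) = evaluate (rev (map (m_inv G) ws)) \<otimes> inv w"
    using Cons.prems by simp
  then show ?case using Cons by (simp add: evaluate_closed inv_mult_group)
qed simp

lemma word_length_alt:
  "wl x = (LEAST n. \<exists>ws. length ws = n \<and> set ws \<subseteq> symmetrized G S \<and> evaluate ws = x)"
  by (simp add: word_length_def symmetrized_def)

lemma word_exists:
  assumes "x \<in> carrier G"
  shows "\<exists>ws. set ws \<subseteq> symmetrized G S \<and> evaluate ws = x"
proof -
  have "x \<in> generate G S" using assms generates by simp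
  then show ?thesis
  proof induction
    case one
    show ?case by (intro exI[of _ "[]"]) simp
  next
    case (incl h)
    then show ?case using generators_closed by (intro exI[of _ "[h]"]) (auto simp: symmetrized_def)
  next
    case (inv h)
    then show ?case using generators_closed by (intro exI[of _ "[inv h]"]) (auto simp: symmetrized_def)
  next
    case (eng a b)
    then obtain us vs where "set us \<subseteq> symmetrized G S" "evaluate us = a"
      "set vs \<subseteq> symmetrized G S" "evaluate vs = b" by blast
    then show ?case
      using symmetrized_closed by (intro exI[of _ "us @ vs"]) (simp add: evaluate_append subset_trans del: foldr_append)
  qed
qed

lemma shortest_word:
  assumes "x \<in> carrier G"
  obtains ws where "set ws \<subseteq> symmetrized G S" "evaluate ws = x" "length ws = wl x"
proof -
  have "\<exists>n. \<exists>ws. length ws = n \<and> set ws \<subseteq> symmetrized G S \<and> evaluate ws = x"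
    using word_exists[OF assms] by blast
  from LeastI_ex[OF this] show ?thesis using that unfolding word_length_alt by blast
qed

lemma word_length_le:
  assumes "set ws \<subseteq> symmetrized G S" "evaluate ws = x"
  shows "wl x \<le> length ws"
  unfolding word_length_alt using assms by (intro Least_le) blast

lemma word_length_one [simp]: "wl \<one> = 0"
  using word_length_le[of "[]" \<one>] by simp

lemma word_length_mult:
  assumes "x \<in> carrier G" "y \<in> carrier G"
  shows "wl (x \<otimes> y) \<le> wl x + wl y"
proof -
  obtain us where us: "set us \<subseteq> symmetrized G S" "evaluate us = x" "length us = wl x"
    using assms(1) by (rule shortest_word)
  obtain vs where vs: "set vs \<subseteq> symmetrized G S" "evaluate vs = y" "length vs = wl y"
    using assms(2) by (rule shortest_word)
  have "wl (x \<otimes> y) \<le> length (us @ vs)"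
    using us vs symmetrized_closed by (intro word_length_le) (auto simp: evaluate_append subset_trans simp del: foldr_append)
  then show ?thesis using us vs by simp
qed

lemma word_length_inv_le:
  assumes "x \<in> carrier G"
  shows "wl (inv x) \<le> wl x"
proof -
  obtain us where us: "set us \<subseteq> symmetrized G S" "evaluate us = x" "length us = wl x"
    using assms by (rule shortest_word)
  have "wl (inv x) \<le> length (rev (map (m_inv G) us))"
    using us symmetrized_closed inv_symmetrized
    by (intro word_length_le) (auto simp: evaluate_inverse subset_trans)
  then show ?thesis using us by simp
qed

lemma word_length_pow:
  assumes "x \<in> carrier G"
  shows "wl (x [^] (k::nat)) \<le> k * wl x"
proof (induction k)
  case (Suc k)
  have "wl (x [^] Suc k) \<le> wl (x [^] k) + wl x"
    using assms by (simp add: word_length_mult)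
  then show ?case using Suc by simp
qed simp

lemma word_length_ball:
  "finite {x \<in> carrier G. wl x \<le> l}"
  "card {x \<in> carrier G. wl x \<le> l} \<le> (card (symmetrized G S) + 1) ^ l"
proof -
  let ?A = "symmetrized G S"
  let ?W = "{ws. set ws \<subseteq> ?A \<and> length ws \<le> l}"
  have sub: "{x \<in> carrier G. wl x \<le> l} \<subseteq> evaluate ` ?W"
  proof
    fix x assume x: "x \<in> {x \<in> carrier G. wl x \<le> l}"
    then obtain ws where "set ws \<subseteq> ?A" "evaluate ws = x" "length ws = wl x"
      using shortest_word by blast
    then show "x \<in> evaluate ` ?W" using x by auto
  qed
  have fin: "finite ?W" using finite_symmetrized by (rule finite_lists_length_le)
  show "finite {x \<in> carrier G. wl x \<le> l}" using sub fin by (meson finite_imageI finite_subset)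
  have "card {x \<in> carrier G. wl x \<le> l} \<le> card ?W"
    using sub fin by (meson card_image_le card_mono finite_imageI le_trans)
  also have "\<dots> = (\<Sum>i\<le>l. card ?A ^ i)" using finite_symmetrized by (rule card_lists_length_le)
  also have "\<dots> \<le> (card ?A + 1) ^ l"
  proof (induction l)
    case (Suc l)
    have "card ?A ^ Suc l \<le> card ?A * (card ?A + 1) ^ l" by (simp add: power_mono)
    then have "(\<Sum>i\<le>Suc l. card ?A ^ i) \<le> (card ?A + 1) ^ l + card ?A * (card ?A + 1) ^ l"
      unfolding sum.atMost_Suc by (rule add_mono[OF Suc.IH])
    then show ?case by (simp add: algebra_simps)
  qed simp
  finally show "card {x \<in> carrier G. wl x \<le> l} \<le> (card ?A + 1) ^ l" .
qed

end

section \<open>Caret numbers are at most exponential in the word length\<close>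

lemma word_exponential_carets:
  assumes "finitely_generated_group Brin_2V S"
  obtains M :: nat where "M > 1"
    "\<And>x. x \<in> carrier Brin_2V \<Longrightarrow> Suc (min_carets x) \<le> M ^ word_length Brin_2V S x"
proof -
  interpret finitely_generated_group Brin_2V S by (fact assms)
  let ?A = "symmetrized Brin_2V S"
  define M where "M = Max (insert 2 ((\<lambda>s. Suc (min_carets s)) ` ?A))"
  have M: "Suc (min_carets s) \<le> M" if "s \<in> ?A" for s
    unfolding M_def using that finite_symmetrized by (intro Max_ge) auto
  have "2 \<le> M" unfolding M_def using finite_symmetrized by (intro Max_ge) auto
  have word: "set ws \<subseteq> ?A \<Longrightarrow> Suc (min_carets (evaluate ws)) \<le> M ^ length ws" for ws
  proof (induction ws)
    case Nil
    show ?case by (simp add: min_carets_one)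
  next
    case (Cons w ws)
    then have "Suc (min_carets (w \<otimes>\<^bsub>Brin_2V\<^esub> evaluate ws)) \<le> Suc (min_carets w) * Suc (min_carets (evaluate ws))"
      using symmetrized_closed by (intro min_carets_mult evaluate_closed) auto
    also have "\<dots> \<le> M * M ^ length ws" using Cons M by (intro mult_le_mono) auto
    finally show ?case by simp
  qed
  show ?thesis
  proof (rule that)
    show "M > 1" using \<open>2 \<le> M\<close> by simp
    show "Suc (min_carets x) \<le> M ^ wl x" if "x \<in> carrier Brin_2V" for x
      using shortest_word[OF that] word by metis
  qed
qed

section \<open>The baker's map\<close>

lemma dyadic_grid_inj:
  fixes i i' k r m :: nat
  assumes "k \<le> r"
    "(real i + 1) / 2 ^ k \<in> {real m / 2 ^ r<..(real m + 1) / 2 ^ r}"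
    "(real i' + 1) / 2 ^ k \<in> {real m / 2 ^ r<..(real m + 1) / 2 ^ r}"
  shows "i = i'"
proof -
  have "\<bar>(real i + 1) / 2 ^ k - (real i' + 1) / 2 ^ k\<bar> < 1 / 2 ^ r"
    using assms(2,3) by (auto simp: add_divide_distrib)
  also have "1 / 2 ^ r \<le> 1 / (2::real) ^ k" using assms(1) by (simp add: frac_le)
  finally have "\<bar>real i - real i'\<bar> / 2 ^ k < 1 / 2 ^ k" by (simp flip: diff_divide_distrib add: abs_divide)
  then have "\<bar>real i - real i'\<bar> < 1" by (simp add: divide_less_cancel)
  then show ?thesis by linarith
qed

text \<open>The upper right corners of the \<open>2 ^ k\<close> vertical strips of equal width lie in pairwise different cells.\<close>
lemma thin_partition_card:
  assumes P: "dyadic_partition P" and thin: "\<And>R. R \<in> P \<Longrightarrow> k \<le> depth Vertical R"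
  shows "2 ^ k \<le> card P"
proof -
  let ?p = "\<lambda>i. ((real i + 1) / 2 ^ k, 1 :: real)"
  have sq: "?p i \<in> unit_square" if "i < 2 ^ k" for i
    using that valid_emb[of "DRect i k 0 0"] emb_in_square[of "DRect i k 0 0" "(1,1)"] by simp
  have "\<exists>R. R \<in> P \<and> ?p i \<in> region R" if "i < 2 ^ k" for i
    using partition_cell[OF P sq[OF that]] by blast
  then obtain c where c: "\<And>i. i < 2 ^ k \<Longrightarrow> c i \<in> P" "\<And>i. i < 2 ^ k \<Longrightarrow> ?p i \<in> region (c i)"
    by metis
  have "inj_on c {..<2 ^ k}"
  proof (rule inj_onI)
    fix i i' :: nat assume i: "i \<in> {..<2 ^ k}" "i' \<in> {..<2 ^ k}" "c i = c i'"
    obtain m r j s where R: "c i = DRect m r j s" by (cases "c i")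
    have "?p i \<in> region (DRect m r j s)" "?p i' \<in> region (DRect m r j s)"
      using c(2)[of i] c(2)[of i'] i R by auto
    moreover have "k \<le> r" using thin[OF c(1)[of i]] i(1) unfolding R by simp
    ultimately show "i = i'" by (intro dyadic_grid_inj[of k r i m i']) auto
  qed
  then have "card {..<(2::nat) ^ k} \<le> card P"
    using c(1) P by (intro card_inj_on_le[of c]) (auto simp: partition_finite)
  then show ?thesis by simp
qed

lemma in_vertical_strip:
  assumes "z \<in> unit_square"
  shows "\<exists>i<2 ^ k. z \<in> region (DRect i k 0 0)"
proof -
  define c where "c = \<lceil>fst z * 2 ^ k\<rceil>"
  have z: "0 < fst z" "fst z \<le> 1" "0 < snd z" "snd z \<le> 1" using assms by (auto simp: unit_square_def)
  have "0 < c" using z by (simp add: c_def)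
  have "fst z * 2 ^ k \<le> of_int (2 ^ k)" using z by simp
  then have "c \<le> 2 ^ k" unfolding c_def by (rule ceiling_le)
  have i: "real (nat (c - 1)) = of_int c - 1" using \<open>0 < c\<close> by simp
  have "int (nat (c - 1)) < int (2 ^ k)" using \<open>0 < c\<close> \<open>c \<le> 2 ^ k\<close> by simp
  then have "nat (c - 1) < 2 ^ k" by (simp only: of_nat_less_iff)
  moreover have "of_int c - 1 < fst z * 2 ^ k" "fst z * 2 ^ k \<le> of_int c" by (simp_all add: c_def) linarith
  then have "z \<in> region (DRect (nat (c - 1)) k 0 0)"
    using z by (cases z) (simp add: i field_simps)
  ultimately show ?thesis by blast
qed

lemma depth_mul: "depth c (R \<odot> Q) = depth c R + depth c Q"
  by (cases R; cases Q; cases c) auto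

text \<open>The baker's map moves the first binary digit of the first coordinate in front of the second
  coordinate, so its \<open>k\<close>-th power turns vertical strips into horizontal ones.\<close>
lemma baker_power_carries:
  assumes b: "b \<in> carrier Brin_2V"
    and c: "\<And>x. carries b (half Vertical x) (half Horizontal x)"
  shows "i < 2 ^ k \<Longrightarrow> \<exists>j. carries (b [^]\<^bsub>Brin_2V\<^esub> (k::nat)) (DRect i k 0 0) (DRect 0 0 j k)"
proof (induction k arbitrary: i)
  case 0
  interpret group Brin_2V by (rule Brin_2V_group)
  show ?case using 0 by (auto simp: carries_def Brin_2V_one)
next
  case (Suc k)
  interpret group Brin_2V by (rule Brin_2V_group)
  obtain x Z where Z: "valid Z" "DRect i (Suc k) 0 0 = half Vertical x \<odot> Z"
    using half_factor[of "DRect i (Suc k) 0 0" Vertical] Suc.prems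
    by (metis depth.simps(1) less_numeral_extra(1) power_0 valid.simps zero_less_Suc)
  then obtain i' where i': "Z = DRect i' k 0 0" "i' < 2 ^ k" by (cases Z) auto
  obtain j where j: "carries (b [^]\<^bsub>Brin_2V\<^esub> k) Z (DRect 0 0 j k)"
    using Suc.IH i' by blast
  have "carries b (half Vertical x \<odot> Z) (half Horizontal x \<odot> Z)" using c Z by (intro carries_mul)
  moreover have "half Horizontal x \<odot> Z = Z \<odot> half Horizontal x" by (simp add: i')
  ultimately have "carries b (half Vertical x \<odot> Z) (Z \<odot> half Horizontal x)" by simp
  moreover have "carries (b [^]\<^bsub>Brin_2V\<^esub> k) (Z \<odot> half Horizontal x) (DRect 0 0 j k \<odot> half Horizontal x)"
    using j by (intro carries_mul valid_half)
  ultimately have "carries (b [^]\<^bsub>Brin_2V\<^esub> k \<otimes>\<^bsub>Brin_2V\<^esub> b) (half Vertical x \<odot> Z) (DRect 0 0 j k \<odot> half Horizontal x)"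
    using b Z by (intro carries_mult) (auto intro: valid_mul)
  then show ?case by (auto simp: Z(2))
qed

text \<open>A cell meets some strip, and on their intersection the map is the same; comparing depths in the first
  coordinate on both sides, with \<open>R'\<close> the image of \<open>R\<close>, gives \<open>depth Vertical R = k + depth Vertical R'\<close>, so all cells are thin.\<close>
lemma exponentially_distorted:
  obtains b where "b \<in> carrier Brin_2V"
    "\<And>k. 2 ^ k \<le> Suc (min_carets (b [^]\<^bsub>Brin_2V\<^esub> (k::nat)))"
proof -
  interpret group Brin_2V by (rule Brin_2V_group)
  let ?P = "{half Vertical False, half Vertical True}"
    and ?Q = "{half Horizontal False, half Horizontal True}"
  let ?f = "\<lambda>R. if R = half Vertical False then half Horizontal False else half Horizontal True"
  have "bij_betw ?f ?P ?Q" by (auto simp: bij_betw_def inj_on_def)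
  from glue_exists[OF partition_halves partition_halves this]
  obtain b where b: "b \<in> carrier Brin_2V" "\<And>R. R \<in> ?P \<Longrightarrow> carries b R (?f R)" by blast
  have c: "carries b (half Vertical x) (half Horizontal x)" for x
    using b(2)[of "half Vertical x"] by (cases x) auto
  show ?thesis
  proof (rule that[OF b(1)])
    fix k :: nat
    let ?g = "b [^]\<^bsub>Brin_2V\<^esub> k"
    have g: "?g \<in> carrier Brin_2V" using b(1) by simp
    then obtain P where P: "pieces P ?g" "card P = Suc (min_carets ?g)" by (rule min_carets_attained)
    have "k \<le> depth Vertical R" if R: "R \<in> P" for R
    proof -
      have vR: "valid R" using R P(1) partition_valid by (auto simp: pieces_def)
      obtain R' where R': "carries ?g R R'" using R P(1) by (auto simp: pieces_def)
      obtain m r j s where Rf: "R = DRect m r j s" by (cases R)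
      have "emb R (1,1) \<in> unit_square" using vR by (simp add: emb_in_square)
      then have "\<exists>i<2 ^ k. emb R (1,1) \<in> region (DRect i k 0 0)" by (rule in_vertical_strip)
      then have "\<exists>i<2 ^ k. region R \<inter> region (DRect i k 0 0) \<noteq> {}"
        using emb_in_region[of R "(1,1)"] one_one_in_square by blast
      then obtain i where i: "i < 2 ^ k" "region R \<inter> region (DRect i k 0 0) \<noteq> {}" by blast
      obtain Z Z' where Z: "valid Z" "valid Z'" "R \<odot> Z = DRect i k 0 0 \<odot> Z'"
        using i(2) by (rule region_meet)
      obtain j' where j': "carries ?g (DRect i k 0 0) (DRect 0 0 j' k)"
        using baker_power_carries[OF b(1) c i(1)] by blast
      have "R' \<odot> Z = DRect 0 0 j' k \<odot> Z'"
        using carries_mul[OF R' Z(1)] carries_mul[OF j' Z(2)] Z(3) carries_unique by metis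
      then have "depth Vertical R' + depth Vertical Z = depth Vertical Z'"
        using depth_mul[of Vertical R' Z] depth_mul[of Vertical "DRect 0 0 j' k" Z'] by simp
      moreover have "depth Vertical R + depth Vertical Z = k + depth Vertical Z'"
        using Z(3) depth_mul[of Vertical R Z] depth_mul[of Vertical "DRect i k 0 0" Z'] by simp
      ultimately show ?thesis by simp
    qed
    then have "2 ^ k \<le> card P" using P(1) by (intro thin_partition_card) (auto simp: pieces_def)
    then show "2 ^ k \<le> Suc (min_carets ?g)" using P(2) by simp
  qed
qed

section \<open>Counting elements\<close>

lemma partition_of_card: "n > 0 \<Longrightarrow> \<exists>P. dyadic_partition P \<and> card P = n"
proof (induction n)
  case (Suc n)
  show ?case
  proof (cases "n = 0")
    case True
    then show ?thesis using partition_root by (intro exI[of _ "{root}"]) auto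
  next
    case False
    then obtain P where P: "dyadic_partition P" "card P = n" using Suc by blast
    then obtain R where "R \<in> P" using partition_nonempty by blast
    then show ?thesis using partition_split_cell[OF P(1), of R Vertical] P(2) by auto
  qed
qed simp

text \<open>Distinct permutations of the cells of one partition give distinct elements. The one of greatest
  word length \<open>l\<close> works, since all \<open>n!\<close> of them lie in the ball of radius \<open>l\<close>.\<close>
lemma many_elements:
  assumes "finitely_generated_group Brin_2V S" "n > 0"
  obtains y where "y \<in> carrier Brin_2V" "min_carets y < n"
    "fact n \<le> (card (symmetrized Brin_2V S) + 1) ^ word_length Brin_2V S y"
proof -
  interpret finitely_generated_group Brin_2V S by (fact assms)
  obtain P where P: "dyadic_partition P" "card P = n" using partition_of_card[OF assms(2)] by blast
  let ?perms = "{p. p permutes P}"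
  have pieces: "pieces P (glue P p)" if "p \<in> ?perms" for p
    using that P by (intro glue_pieces) (auto simp: permutes_imp_bij)
  then have closed: "glue P p \<in> carrier Brin_2V" if "p \<in> ?perms" for p
    using that carrier_iff_pieces by blast
  have fin: "finite ?perms" using P by (intro finite_permutations partition_finite)
  have "inj_on (glue P) ?perms"
  proof (rule inj_onI, rule ext)
    fix p q R assume pq: "p \<in> ?perms" "q \<in> ?perms" "glue P p = glue P q"
    show "p R = q R"
    proof (cases "R \<in> P")
      case True
      then show ?thesis using glue_carries[OF P(1)] pq(3) carries_unique by metis
    next
      case False
      then show ?thesis using pq by (auto simp: permutes_def)
    qed
  qed
  then have card: "card (glue P ` ?perms) = fact n"
    using P by (simp add: card_image card_permutations partition_finite)
  define l where "l = Max (wl ` glue P ` ?perms)"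
  have "wl ` glue P ` ?perms \<noteq> {}" using permutes_id by blast
  then have "l \<in> wl ` glue P ` ?perms" unfolding l_def using fin by (intro Max_in) auto
  then obtain p where p: "p \<in> ?perms" "wl (glue P p) = l" by auto
  have "glue P ` ?perms \<subseteq> {x \<in> carrier Brin_2V. wl x \<le> l}"
    using closed fin by (auto simp: l_def)
  then have "fact n \<le> card {x \<in> carrier Brin_2V. wl x \<le> l}"
    unfolding card[symmetric] using word_length_ball(1) by (intro card_mono)
  also have "\<dots> \<le> (card (symmetrized Brin_2V S) + 1) ^ l" by (rule word_length_ball)
  finally show ?thesis
    using that[of "glue P p"] closed[OF p(1)] p(2) min_carets_le[OF pieces[OF p(1)]] P(2) by simp
qed

text \<open>Pairing the factors \<open>k\<close> and \<open>n + 1 - k\<close> of the factorial, whose product is at least \<open>n\<close>, gives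
  \<open>n ^ n \<le> (n!)\<^sup>2\<close>.\<close>
lemma ln_fact_ge: "real n * ln (real n) \<le> 2 * ln (fact n)"
proof (cases "n = 0")
  case False
  have "n ^ n \<le> fact n * fact n"
  proof -
    have "n ^ n = (\<Prod>k\<in>{1..n}. n)" by simp
    also have "\<dots> \<le> (\<Prod>k\<in>{1..n}. k * (n + 1 - k))"
    proof (intro prod_mono conjI)
      fix k assume "k \<in> {1..n}"
      then obtain a b where "k = Suc a" "n = k + b" by (metis Suc_diff_1 atLeastAtMost_iff le_add_diff_inverse less_eq_Suc_le One_nat_def)
      then show "n \<le> k * (n + 1 - k)" by (simp add: algebra_simps)
    qed simp
    also have "\<dots> = (\<Prod>k\<in>{1..n}. k) * (\<Prod>k\<in>{1..n}. n + 1 - k)" by (rule prod.distrib)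
    also have "(\<Prod>k\<in>{1..n}. n + 1 - k) = (\<Prod>k\<in>{1..n}. k)"
      by (rule prod.reindex_bij_witness[of _ "\<lambda>k. n + 1 - k" "\<lambda>k. n + 1 - k"]) auto
    finally show ?thesis by (simp add: fact_prod)
  qed
  then have "real (n ^ n) \<le> real (fact n * fact n)" by (simp only: of_nat_le_iff)
  then have "real n ^ n \<le> (fact n :: real) * fact n" by (simp del: of_nat_mult add: of_nat_mult)
  then have "ln (real n ^ n) \<le> ln ((fact n :: real) * fact n)" using False by (intro ln_mono) auto
  then show ?thesis using False by (simp add: ln_realpow ln_mult)
qed simp

section \<open>Vertical strips and double transitivity\<close>

text \<open>The vertical strip of points whose first coordinate starts with the given binary digits.\<close>
fun cell :: "bool list \<Rightarrow> drect" where
  "cell [] = root"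
| "cell (b # w) = half Vertical b \<odot> cell w"

lemma valid_cell [simp]: "valid (cell w)"
  by (induction w) (auto simp: valid_mul)

lemma cell_append: "cell (u @ w) = cell u \<odot> cell w"
  by (induction u) (auto simp: dmul_assoc)

lemma halves_disjoint: "a \<noteq> b \<Longrightarrow> region (half c a) \<inter> region (half c b) = {}"
  using partition_disjoint'[OF partition_halves, of "half c a" c "half c b"]
  by (cases a; cases b) (auto simp: half_inj)

lemma parallel_cells_disjoint:
  assumes "u \<parallel> w"
  shows "region (cell u) \<inter> region (cell w) = {}"
proof -
  obtain p a x b y where uw: "a \<noteq> b" "u = p @ a # x" "w = p @ b # y"
    using parallel_decomp[OF assms] by blast
  have "region (cell (a # x)) \<inter> region (cell (b # y)) = {}"
    using halves_disjoint[OF uw(1), of Vertical] region_mul_subset[OF valid_cell, of "half Vertical a" x]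
      region_mul_subset[OF valid_cell, of "half Vertical b" y] unfolding cell.simps by blast
  then show ?thesis
    unfolding uw cell_append region_mul by (auto simp: emb_inj simp del: cell.simps)
qed

lemma partition_with_cell:
  "\<exists>P. dyadic_partition P \<and> cell w \<in> P \<and> length w < card P"
proof (induction w)
  case Nil
  show ?case using partition_root by (intro exI[of _ "{root}"]) simp
next
  case (Cons b w)
  then obtain P where P: "dyadic_partition P" "cell w \<in> P" "length w < card P" by blast
  show ?case
  proof (cases b)
    case True
    then show ?thesis
      using partition_join[OF partition_root P(1), of Vertical] P by fastforce
  next
    case False
    then show ?thesis
      using partition_join[OF P(1) partition_root, of Vertical] P by fastforce
  qed
qed

lemma partition_with_parallel_cells:
  assumes "u \<parallel> w"
  shows "\<exists>P. dyadic_partition P \<and> cell u \<in> P \<and> cell w \<in> P \<and> length u < card P \<and> length w < card P"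
  using assms
proof (induction u arbitrary: w)
  case Nil
  then show ?case by simp
next
  case (Cons a u)
  then obtain b v where w: "w = b # v" by (cases w) auto
  show ?case
  proof (cases "a = b")
    case True
    then have "u \<parallel> v" using Cons.prems by (simp add: w parallel_def)
    then obtain P where P: "dyadic_partition P" "cell u \<in> P" "cell v \<in> P" "length u < card P" "length v < card P"
      using Cons.IH by blast
    show ?thesis
    proof (cases a)
      case t: True
      show ?thesis
        using partition_join[OF partition_root P(1), of Vertical] P w True t by fastforce
    next
      case f: False
      show ?thesis
        using partition_join[OF P(1) partition_root, of Vertical] P w True f by fastforce
    qed
  next
    case False
    obtain P where P: "dyadic_partition P" "cell u \<in> P" "length u < card P"
      using partition_with_cell by blast
    obtain Q where Q: "dyadic_partition Q" "cell v \<in> Q" "length v < card Q"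
      using partition_with_cell by blast
    show ?thesis
    proof (cases a)
      case t: True
      then have "\<not> b" using False by simp
      then show ?thesis
        using partition_join[OF Q(1) P(1), of Vertical] P Q w t by fastforce
    next
      case f: False
      then have "b" using False by simp
      then show ?thesis
        using partition_join[OF P(1) Q(1), of Vertical] P Q w f by fastforce
    qed
  qed
qed

text \<open>A third cell, distinct from \<open>A\<close> and \<open>B\<close>, can be halved again and again.\<close>
lemma partition_enlarge:
  assumes "dyadic_partition P" "A \<in> P" "B \<in> P" "3 \<le> card P" "card P \<le> n"
  shows "\<exists>Q. dyadic_partition Q \<and> A \<in> Q \<and> B \<in> Q \<and> card Q = n"
  using assms(5)
proof (induction n rule: dec_induct)
  case base
  then show ?case using assms by blast
next
  case (step n)
  then obtain Q where Q: "dyadic_partition Q" "A \<in> Q" "B \<in> Q" "card Q = n" by blast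
  have "\<not> Q \<subseteq> {A, B}"
  proof
    assume "Q \<subseteq> {A, B}"
    then have "card Q \<le> card {A, B}" by (intro card_mono) auto
    also have "\<dots> \<le> 2" by (simp add: card_insert_if)
    finally show False using Q(4) step.hyps assms(4) by linarith
  qed
  then obtain R where "R \<in> Q" "R \<noteq> A" "R \<noteq> B" by blast
  then show ?case using partition_split_cell[OF Q(1), of R Vertical] Q by auto
qed

text \<open>After enlarging the two partitions to the same number of cells, any bijection of the cells that sends
  \<open>A\<close> to \<open>A'\<close> and \<open>B\<close> to \<open>B'\<close> can be glued. The hypothesis on the number of cells excludes two
  halves that fill the square; they cannot be sent to two strips that leave a gap.\<close>
lemma two_transitive:
  assumes P: "dyadic_partition P" "A \<in> P" "B \<in> P" "A \<noteq> B" "3 \<le> card P"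
    and Q: "dyadic_partition Q" "A' \<in> Q" "B' \<in> Q" "A' \<noteq> B'" "3 \<le> card Q"
  obtains f where "f \<in> carrier Brin_2V" "carries f A A'" "carries f B B'"
proof -
  define n where "n = max (card P) (card Q)"
  obtain P1 where P1: "dyadic_partition P1" "A \<in> P1" "B \<in> P1" "card P1 = n"
    using partition_enlarge[OF P(1,2,3,5), of n] by (auto simp: n_def)
  obtain Q1 where Q1: "dyadic_partition Q1" "A' \<in> Q1" "B' \<in> Q1" "card Q1 = n"
    using partition_enlarge[OF Q(1,2,3,5), of n] by (auto simp: n_def)
  have fin: "finite (P1 - {A, B})" "finite (Q1 - {A', B'})"
    using P1 Q1 by (auto simp: partition_finite)
  have "card (P1 - {A, B}) = card (Q1 - {A', B'})"
    using P1 Q1 P(4) Q(4) by (simp add: card_Diff_subset)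
  from finite_same_card_bij[OF fin this]
  obtain g where g: "bij_betw g (P1 - {A, B}) (Q1 - {A', B'})" by blast
  let ?\<phi> = "\<lambda>R. if R = A then A' else if R = B then B' else g R"
  have "bij_betw ?\<phi> (P1 - {A, B}) (Q1 - {A', B'})"
    using g by (subst bij_betw_cong[of _ _ g]) auto
  moreover have "bij_betw ?\<phi> {A, B} {A', B'}" using P(4) Q(4) by (auto simp: bij_betw_def inj_on_def)
  ultimately have "bij_betw ?\<phi> ((P1 - {A, B}) \<union> {A, B}) ((Q1 - {A', B'}) \<union> {A', B'})"
    by (rule bij_betw_combine) auto
  moreover have "(P1 - {A, B}) \<union> {A, B} = P1" "(Q1 - {A', B'}) \<union> {A', B'} = Q1" using P1 Q1 by auto
  ultimately have "bij_betw ?\<phi> P1 Q1" by simp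
  from glue_exists[OF P1(1) Q1(1) this] obtain f where
    f: "f \<in> carrier Brin_2V" "\<And>R. R \<in> P1 \<Longrightarrow> carries f R (?\<phi> R)" by blast
  show ?thesis
    using that[OF f(1)] f(2)[of A] f(2)[of B] P1 P(4) by auto
qed

text \<open>Disjoint strips that together do not fill the square: incomparable words fill it only if they are
  the two one-letter words.\<close>
definition spread :: "bool list \<Rightarrow> bool list \<Rightarrow> bool" where
  "spread u w \<longleftrightarrow> u \<parallel> w \<and> (2 \<le> length u \<or> 2 \<le> length w)"

lemma spread_two_transitive:
  assumes "spread u w" "spread u' w'"
  obtains f where "f \<in> carrier Brin_2V" "carries f (cell u) (cell u')" "carries f (cell w) (cell w')"
proof -
  have ne: "cell u \<noteq> cell w" if "u \<parallel> w" for u w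
    using parallel_cells_disjoint[OF that] region_nonempty by (metis inf.idem)
  obtain P where P: "dyadic_partition P" "cell u \<in> P" "cell w \<in> P" "3 \<le> card P"
    using assms(1) partition_with_parallel_cells[of u w] by (fastforce simp: spread_def)
  obtain Q where Q: "dyadic_partition Q" "cell u' \<in> Q" "cell w' \<in> Q" "3 \<le> card Q"
    using assms(2) partition_with_parallel_cells[of u' w'] by (fastforce simp: spread_def)
  show ?thesis
    using two_transitive[OF P(1-3) _ P(4) Q(1-3) _ Q(4)] ne assms that by (auto simp: spread_def)
qed

section \<open>Standard partitions numbered like a binary heap\<close>

text \<open>The path from the root to node \<open>n\<close> of the infinite binary tree in heap order, where node \<open>n\<close>
  has the children \<open>2 n\<close> and \<open>2 n + 1\<close> and the root is node \<open>1\<close>.\<close>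
fun node :: "nat \<Rightarrow> bool list" where
  "node n = (if n \<le> 1 then [] else node (n div 2) @ [odd n])"

declare node.simps [simp del]

lemma node_1: "node (Suc 0) = []" "node 1 = []"
  by (simp_all add: node.simps)

lemma node_double: "n > 0 \<Longrightarrow> node (2 * n) = node n @ [False]" "n > 0 \<Longrightarrow> node (Suc (2 * n)) = node n @ [True]"
  by (subst node.simps; simp)+

lemma length_node: "n > 0 \<Longrightarrow> 2 ^ length (node n) \<le> n"
proof (induction n rule: node.induct)
  case (1 n)
  show ?case
  proof (cases "n \<le> 1")
    case True
    then show ?thesis using 1 by (simp add: node.simps)
  next
    case False
    then have "2 ^ length (node (n div 2)) \<le> n div 2" using 1 by auto
    then show ?thesis using False by (subst node.simps) auto
  qed
qed

lemma length_node_ge_2: "n \<ge> 4 \<Longrightarrow> 2 \<le> length (node n)"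
  by (subst node.simps, subst node.simps) auto

abbreviation heap_cell :: "nat \<Rightarrow> drect" where
  "heap_cell n \<equiv> cell (node n)"

lemma heap_cell_double:
  assumes "n > 0"
  shows "heap_cell (2 * n) = heap_cell n \<odot> half Vertical False"
    "heap_cell (Suc (2 * n)) = heap_cell n \<odot> half Vertical True"
  using assms by (simp_all add: node_double cell_append)

definition heap_level :: "nat \<Rightarrow> drect set" where
  "heap_level n = heap_cell ` {n..<2 * n}"

text \<open>Going from \<open>n\<close> to \<open>n + 1\<close> replaces node \<open>n\<close> by its two children, that is, halves one cell.\<close>
lemma heap_level:
  assumes "n > 0"
  shows "dyadic_partition (heap_level n)" "card (heap_level n) = n" "inj_on heap_cell {n..<2 * n}"
proof -
  have "dyadic_partition (heap_level n) \<and> card (heap_level n) = n"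
    using assms
  proof (induction n rule: nat_induct_non_zero)
    case 1
    have "{1..<2 * 1} = {1::nat}" by auto
    then show ?case using partition_root by (simp add: heap_level_def node_1)
  next
    case (Suc n)
    then have inj: "inj_on heap_cell {n..<2 * n}"
      by (intro eq_card_imp_inj_on) (auto simp: heap_level_def)
    have n: "heap_cell n \<in> heap_level n" using Suc.hyps by (simp add: heap_level_def)
    have "{Suc n..<2 * Suc n} = ({n..<2 * n} - {n}) \<union> {2 * n, Suc (2 * n)}" using Suc.hyps by auto
    then have "heap_level (Suc n) = heap_cell ` ({n..<2 * n} - {n}) \<union> {heap_cell (2 * n), heap_cell (Suc (2 * n))}"
      unfolding heap_level_def by (simp add: image_Un)
    also have "heap_cell ` ({n..<2 * n} - {n}) = heap_level n - {heap_cell n}"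
      unfolding heap_level_def using Suc.hyps inj by (subst inj_on_image_set_diff[OF inj]) auto
    finally show ?case
      using partition_split_cell[OF _ n, of Vertical] Suc by (simp add: heap_cell_double)
  qed
  then show 1: "dyadic_partition (heap_level n)" and 2: "card (heap_level n) = n" by auto
  then show "inj_on heap_cell {n..<2 * n}" by (intro eq_card_imp_inj_on) (auto simp: heap_level_def)
qed

lemma heap_cells_disjoint:
  assumes "a \<in> {n..<2 * n}" "b \<in> {n..<2 * n}" "a \<noteq> b"
  shows "region (heap_cell a) \<inter> region (heap_cell b) = {}"
proof -
  have n: "n > 0" using assms by auto
  have "heap_cell a \<noteq> heap_cell b" using heap_level(3)[OF n] assms by (auto simp: inj_on_def)
  then show ?thesis
    using partition_disjoint'[OF heap_level(1)[OF n]] assms by (simp add: heap_level_def)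
qed

lemma heap_parallel:
  assumes "a \<in> {n..<2 * n}" "b \<in> {n..<2 * n}" "a \<noteq> b"
  shows "node a \<parallel> node b"
proof -
  have "\<not> prefix (node a) (node b)" if "region (heap_cell a) \<inter> region (heap_cell b) = {}" for a b
  proof
    assume "prefix (node a) (node b)"
    then obtain w where "node b = node a @ w" by (auto simp: prefix_def)
    then have "region (heap_cell b) \<subseteq> region (heap_cell a)"
      using region_mul_subset[OF valid_cell] by (simp add: cell_append)
    then show False using that region_nonempty by blast
  qed
  then show ?thesis using heap_cells_disjoint assms by (auto intro!: parallelI)
qed

lemma heap_spread:
  assumes "a \<in> {n..<2 * n}" "b \<in> {n..<2 * n}" "a \<noteq> b" "n \<ge> 3"
  shows "spread (node a) (node b)"
proof -
  have "a \<ge> 4 \<or> b \<ge> 4" using assms by auto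
  then show ?thesis
    using heap_parallel[OF assms(1-3)] length_node_ge_2[of a] length_node_ge_2[of b] by (auto simp: spread_def)
qed

text \<open>The two kinds of elements from which all others are assembled: a transposition of two cells of the
  level \<open>n\<close>, and an element that turns a horizontal cut of cell \<open>n\<close> into a vertical one.\<close>
definition swaps :: "nat \<Rightarrow> nat \<Rightarrow> nat \<Rightarrow> (real \<times> real \<Rightarrow> real \<times> real) \<Rightarrow> bool" where
  "swaps n a b f \<longleftrightarrow> f \<in> carrier Brin_2V \<and>
     carries f (heap_cell a) (heap_cell b) \<and> carries f (heap_cell b) (heap_cell a) \<and>
     (\<forall>m\<in>{n..<2 * n} - {a, b}. carries f (heap_cell m) (heap_cell m))"

definition turns :: "nat \<Rightarrow> (real \<times> real \<Rightarrow> real \<times> real) \<Rightarrow> bool" where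
  "turns n f \<longleftrightarrow> f \<in> carrier Brin_2V \<and>
     (\<forall>x. carries f (heap_cell n \<odot> half Horizontal x) (heap_cell n \<odot> half Vertical x)) \<and>
     (\<forall>m\<in>{n<..<2 * n}. carries f (heap_cell m) (heap_cell m))"

lemma swap_element:
  assumes P: "dyadic_partition P" "A \<in> P" "B \<in> P"
  obtains f where "f \<in> carrier Brin_2V" "carries f A B" "carries f B A"
    "\<And>R. R \<in> P \<Longrightarrow> R \<noteq> A \<Longrightarrow> R \<noteq> B \<Longrightarrow> carries f R R"
proof -
  let ?\<phi> = "transpose A B"
  have "bij_betw ?\<phi> P P" by (rule permutes_imp_bij[OF permutes_swap_id[OF P(2,3)]])
  from glue_exists[OF P(1) P(1) this] obtain f where
    f: "f \<in> carrier Brin_2V" "\<And>R. R \<in> P \<Longrightarrow> carries f R (?\<phi> R)" by blast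
  show ?thesis
  proof (rule that[OF f(1)])
    show "carries f A B" "carries f B A" using f(2)[of A] f(2)[of B] P by auto
    show "carries f R R" if "R \<in> P" "R \<noteq> A" "R \<noteq> B" for R
      using f(2)[OF that(1)] that by (simp add: transpose_def)
  qed
qed

lemma turn_element:
  assumes P: "dyadic_partition P" "A \<in> P"
  obtains f where "f \<in> carrier Brin_2V"
    "\<And>x. carries f (A \<odot> half Horizontal x) (A \<odot> half Vertical x)"
    "\<And>R. R \<in> P \<Longrightarrow> R \<noteq> A \<Longrightarrow> carries f R R"
proof -
  let ?S = "\<lambda>c. P - {A} \<union> {A \<odot> half c False, A \<odot> half c True}"
  have notin: "A \<odot> half c x \<notin> P" for c x
  proof
    assume "A \<odot> half c x \<in> P"
    moreover have "region (A \<odot> half c x) \<inter> region A \<noteq> {}"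
      using region_mul_subset[OF valid_half, of A c x] region_nonempty by blast
    ultimately have "A \<odot> half c x = A" using P partition_disjoint' by blast
    then have "half c x = root" by (metis dmul_left_cancel dmul_root(2))
    then show False by (cases c) auto
  qed
  let ?\<phi> = "\<lambda>R. if R = A \<odot> half Horizontal False then A \<odot> half Vertical False
    else if R = A \<odot> half Horizontal True then A \<odot> half Vertical True else R"
  have inj: "inj_on ?\<phi> (?S Horizontal)"
    using notin by (auto simp: inj_on_def dmul_left_cancel half_inj simp del: half.simps)
  have fixed: "?\<phi> R = R" if "R \<in> P" for R
    using notin[of Horizontal False] notin[of Horizontal True] that by metis
  have "?\<phi> ` (P - {A}) = id ` (P - {A})" using fixed by (intro image_cong) simp_all
  then have "?\<phi> ` (P - {A}) = P - {A}" by simp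
  moreover have "?\<phi> ` {A \<odot> half Horizontal False, A \<odot> half Horizontal True} =
      {A \<odot> half Vertical False, A \<odot> half Vertical True}"
    by (auto simp: dmul_left_cancel half_inj simp del: half.simps)
  ultimately have "?\<phi> ` ?S Horizontal = ?S Vertical" by (simp only: image_Un)
  then have "bij_betw ?\<phi> (?S Horizontal) (?S Vertical)" using inj by (simp add: bij_betw_def)
  from glue_exists[OF partition_split_cell(1)[OF P] partition_split_cell(1)[OF P] this] obtain f where
    f: "f \<in> carrier Brin_2V" "\<And>R. R \<in> ?S Horizontal \<Longrightarrow> carries f R (?\<phi> R)" by blast
  show ?thesis
  proof (rule that[OF f(1)])
    show "carries f (A \<odot> half Horizontal x) (A \<odot> half Vertical x)" for x
      using f(2)[of "A \<odot> half Horizontal x"] by (cases x) (auto simp: dmul_left_cancel half_inj simp del: half.simps)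
    show "carries f R R" if "R \<in> P" "R \<noteq> A" for R
      using f(2)[of R] that fixed[OF that(1)] by simp
  qed
qed

lemma swaps_exists:
  assumes "a \<in> {n..<2 * n}" "b \<in> {n..<2 * n}"
  shows "\<exists>f. swaps n a b f"
proof -
  have n: "n > 0" using assms by auto
  have "heap_cell a \<in> heap_level n" "heap_cell b \<in> heap_level n" using assms by (auto simp: heap_level_def)
  from swap_element[OF heap_level(1)[OF n] this] obtain f where
    f: "f \<in> carrier Brin_2V" "carries f (heap_cell a) (heap_cell b)" "carries f (heap_cell b) (heap_cell a)"
    "\<And>R. R \<in> heap_level n \<Longrightarrow> R \<noteq> heap_cell a \<Longrightarrow> R \<noteq> heap_cell b \<Longrightarrow> carries f R R" by blast
  have "carries f (heap_cell m) (heap_cell m)" if "m \<in> {n..<2 * n} - {a, b}" for m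
    using f(4)[of "heap_cell m"] that assms
    by (auto simp: heap_level_def inj_on_eq_iff[OF heap_level(3)[OF n]])
  then show ?thesis using f unfolding swaps_def by blast
qed

lemma turns_exists:
  assumes n: "n > 0"
  shows "\<exists>f. turns n f"
proof -
  have "heap_cell n \<in> heap_level n" using assms by (auto simp: heap_level_def)
  from turn_element[OF heap_level(1)[OF n] this] obtain f where
    f: "f \<in> carrier Brin_2V" "\<And>x. carries f (heap_cell n \<odot> half Horizontal x) (heap_cell n \<odot> half Vertical x)"
    "\<And>R. R \<in> heap_level n \<Longrightarrow> R \<noteq> heap_cell n \<Longrightarrow> carries f R R" by blast
  have "carries f (heap_cell m) (heap_cell m)" if "m \<in> {n<..<2 * n}" for m
    using f(3)[of "heap_cell m"] that n
    by (auto simp: heap_level_def inj_on_eq_iff[OF heap_level(3)[OF n]])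
  then show ?thesis using f unfolding turns_def by blast
qed

text \<open>Two fixed strips and the rest of the square. Every swap or turn on a large level is a
  conjugate of one fixed element that acts inside \<open>E0\<close> and \<open>E1\<close>.\<close>
abbreviation E0 :: drect where "E0 \<equiv> cell [False, False]"
abbreviation E1 :: drect where "E1 \<equiv> cell [False, True]"
abbreviation E2 :: drect where "E2 \<equiv> cell [True]"

lemma E_partition: "dyadic_partition {E0, E1, E2}"
proof -
  have "heap_level 3 = {E0, E1, E2}"
  proof -
    have "{3..<2 * 3} = {3, 4, 5::nat}" by auto
    then show ?thesis by (auto simp: heap_level_def node.simps)
  qed
  then show ?thesis using heap_level(1)[of 3] by simp
qed

lemma conjugate_carries:
  assumes g: "g \<in> carrier Brin_2V"
    and h: "h \<in> carrier Brin_2V" "carries h X X'"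
    and Y: "carries g Y X" "valid Y" "carries g Y' X'" "valid Y'"
  shows "carries (inv\<^bsub>Brin_2V\<^esub> g \<otimes>\<^bsub>Brin_2V\<^esub> (h \<otimes>\<^bsub>Brin_2V\<^esub> g)) Y Y'"
proof -
  interpret group Brin_2V by (rule Brin_2V_group)
  have "carries (h \<otimes>\<^bsub>Brin_2V\<^esub> g) Y X'" using carries_mult g h Y by blast
  moreover have "carries (inv\<^bsub>Brin_2V\<^esub> g) X' Y'" using carries_inv g Y by blast
  ultimately show ?thesis using g h Y by (intro carries_mult[OF inv_closed m_closed]) auto
qed

text \<open>Outside \<open>A\<close> and \<open>B\<close> the element \<open>g\<close> takes values in \<open>E2\<close>, where \<open>h\<close> is the identity. The image
  of \<open>C\<close> under \<open>g\<close> need not be a rectangle, so the argument is pointwise.\<close>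
lemma conjugate_fixes:
  assumes g: "g \<in> carrier Brin_2V" "carries g A E0" "carries g B E1" "valid A" "valid B"
    and h: "h \<in> carrier Brin_2V" "carries h E2 E2"
    and C: "valid C" "region C \<inter> region A = {}" "region C \<inter> region B = {}"
  shows "carries (inv\<^bsub>Brin_2V\<^esub> g \<otimes>\<^bsub>Brin_2V\<^esub> (h \<otimes>\<^bsub>Brin_2V\<^esub> g)) C C"
  unfolding carries_def
proof
  interpret group Brin_2V by (rule Brin_2V_group)
  fix z assume z: "z \<in> unit_square"
  let ?y = "emb C z"
  have y: "?y \<in> unit_square" "?y \<in> region C" using z C emb_in_square by auto
  have gB: "bij_betw g unit_square unit_square" using carrier_Bij[OF g(1)] by (simp add: Bij_def)
  have gy: "g ?y \<in> unit_square" using y(1) gB by (auto simp: bij_betw_def)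
  have out: "g ?y \<notin> region (cell e)" if c: "carries g A' (cell e)" "valid A'" "region C \<inter> region A' = {}" for e A'
  proof
    assume "g ?y \<in> region (cell e)"
    then obtain x where x: "x \<in> region A'" "g ?y = g x" using carries_image[OF c(1)] by blast
    then have "x \<in> unit_square" using c(2) valid_emb by blast
    then have "?y = x" using x(2) y(1) gB by (auto simp: bij_betw_def inj_on_def)
    then show False using x(1) y(2) c(3) by blast
  qed
  have "g ?y \<in> region E2"
    using partition_cell[OF E_partition gy] out[OF g(2,4) C(2)] out[OF g(3,5) C(3)] by blast
  then obtain x where "x \<in> unit_square" "g ?y = emb E2 x" unfolding region_emb by blast
  then have "h (g ?y) = g ?y" using h(2) by (simp add: carries_def)
  moreover have "(inv\<^bsub>Brin_2V\<^esub> g) (g ?y) = ?y"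
    using gB y(1) gy by (simp add: Brin_2V_inv[OF g(1)] bij_betw_def)
  ultimately show "(inv\<^bsub>Brin_2V\<^esub> g \<otimes>\<^bsub>Brin_2V\<^esub> (h \<otimes>\<^bsub>Brin_2V\<^esub> g)) ?y = ?y"
    using g h y(1) gy by (simp add: mult_apply)
qed

section \<open>Removing a caret\<close>

lemma half_mul_eq:
  assumes "valid R" "valid Q" "half c a \<odot> R = half c b \<odot> Q"
  shows "a = b"
proof (rule ccontr)
  assume "a \<noteq> b"
  then have "region (half c a \<odot> R) \<inter> region (half c b \<odot> Q) = {}"
    using halves_disjoint region_mul_subset assms(1,2) by blast
  then show False using assms(3) region_nonempty by auto
qed

text \<open>Every tree other than a single leaf has a caret with two leaves as children; \<open>T0\<close> is the tree without it,
  and \<open>R\<close> is the leaf that takes its place. The inclusion is in fact an equality.\<close>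
lemma remove_caret:
  assumes "T \<noteq> Leaf"
  shows "\<exists>T0 R c. num_leaves T = Suc (num_leaves T0) \<and> R \<in> leaves T0 \<and>
    leaves T \<subseteq> (leaves T0 - {R}) \<union> range (\<lambda>x. R \<odot> half c x)"
  using assms
proof (induction T)
  case (Caret c l r)
  have v: "valid R" if "R \<in> leaves T" for R T using that leaves_partition partition_valid by blast
  consider "l \<noteq> Leaf" | "r \<noteq> Leaf" | "l = Leaf" "r = Leaf" by blast
  then show ?case
  proof cases
    case 1
    then obtain l0 R d where l0: "num_leaves l = Suc (num_leaves l0)" "R \<in> leaves l0"
      "leaves l \<subseteq> (leaves l0 - {R}) \<union> range (\<lambda>x. R \<odot> half d x)" using Caret.IH(1) by blast
    have "half c True \<odot> Y \<noteq> half c False \<odot> R" if "Y \<in> leaves r" for Y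
      using half_mul_eq[of Y R c True False] v[OF that] v[OF l0(2)] by blast
    then have "(\<odot>) (half c True) ` leaves r \<subseteq> leaves (Caret c l0 r) - {half c False \<odot> R}"
      by (auto simp: leaves_Caret simp del: half.simps)
    moreover have "(\<odot>) (half c False) ` leaves l \<subseteq>
        (leaves (Caret c l0 r) - {half c False \<odot> R}) \<union> range (\<lambda>x. half c False \<odot> R \<odot> half d x)"
      using l0(3) unfolding leaves_Caret dmul_assoc by (auto simp: dmul_left_cancel simp del: half.simps)
    ultimately show ?thesis
      using l0(1,2) by (intro exI[of _ "Caret c l0 r"] exI[of _ "half c False \<odot> R"] exI[of _ d])
        (auto simp: leaves_Caret simp del: half.simps)
  next
    case 2
    then obtain r0 R d where r0: "num_leaves r = Suc (num_leaves r0)" "R \<in> leaves r0"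
      "leaves r \<subseteq> (leaves r0 - {R}) \<union> range (\<lambda>x. R \<odot> half d x)" using Caret.IH(2) by blast
    have "half c False \<odot> Y \<noteq> half c True \<odot> R" if "Y \<in> leaves l" for Y
      using half_mul_eq[of Y R c False True] v[OF that] v[OF r0(2)] by blast
    then have "(\<odot>) (half c False) ` leaves l \<subseteq> leaves (Caret c l r0) - {half c True \<odot> R}"
      by (auto simp: leaves_Caret simp del: half.simps)
    moreover have "(\<odot>) (half c True) ` leaves r \<subseteq>
        (leaves (Caret c l r0) - {half c True \<odot> R}) \<union> range (\<lambda>x. half c True \<odot> R \<odot> half d x)"
      using r0(3) unfolding leaves_Caret dmul_assoc by (auto simp: dmul_left_cancel simp del: half.simps)
    ultimately show ?thesis
      using r0(1,2) by (intro exI[of _ "Caret c l r0"] exI[of _ "half c True \<odot> R"] exI[of _ d])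
        (auto simp: leaves_Caret simp del: half.simps)
  next
    case 3
    show ?thesis
      by (intro exI[of _ Leaf] exI[of _ root] exI[of _ c]) (auto simp: 3 leaves_Caret leaves_Leaf simp del: half.simps)
  qed
qed simp

lemma carries_inj:
  assumes "f \<in> carrier Brin_2V" "carries f R Q" "carries f R' Q" "valid R" "valid R'"
  shows "R = R'"
  using carries_inv[OF assms(1,2,4)] carries_inv[OF assms(1,3,5)] carries_unique by blast

lemma carries_one: "valid R \<Longrightarrow> carries (\<one>\<^bsub>Brin_2V\<^esub>) R R"
  by (simp add: carries_def Brin_2V_one emb_in_square)

section \<open>Swaps and turns of logarithmic length\<close>

locale generated_2V = finitely_generated_group Brin_2V S for S
begin

text \<open>Finitely many tasks, each solved by some element, are solved by elements of bounded word length.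
  The bounds below use an arbitrary generating set through this principle only: the elements in the
  finite supply have some word in the generators, and its length is a constant.\<close>
lemma uniform_choice:
  assumes "finite W" "\<And>q. q \<in> W \<Longrightarrow> \<exists>f. \<Phi> q f"
  shows "\<exists>L. \<forall>q\<in>W. \<exists>f. \<Phi> q f \<and> wl f \<le> L"
proof -
  obtain F where F: "\<forall>q\<in>W. \<Phi> q (F q)" using assms(2) by metis
  have "wl (F q) \<le> (\<Sum>q\<in>W. wl (F q))" if "q \<in> W" for q
    using assms(1) that by (intro member_le_sum) auto
  then show ?thesis using F by blast
qed

lemma short_words_bounded:
  "\<exists>L. \<forall>u w u' w'. spread u w \<longrightarrow> spread u' w' \<longrightarrow>
    length u \<le> 4 \<longrightarrow> length w \<le> 4 \<longrightarrow> length u' \<le> 4 \<longrightarrow> length w' \<le> 4 \<longrightarrow>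
    (\<exists>f. f \<in> carrier Brin_2V \<and> carries f (cell u) (cell u') \<and> carries f (cell w) (cell w') \<and> wl f \<le> L)"
proof -
  let ?A = "{u :: bool list. set u \<subseteq> UNIV \<and> length u \<le> 4}"
  let ?W = "{(u, w, u', w'). spread u w \<and> spread u' w'} \<inter> (?A \<times> ?A \<times> ?A \<times> ?A)"
  let ?\<Phi> = "\<lambda>(u, w, u', w') f. f \<in> carrier Brin_2V \<and> carries f (cell u) (cell u') \<and> carries f (cell w) (cell w')"
  have "finite ?A" by (rule finite_lists_length_le) simp
  then have "finite ?W" by blast
  moreover have "\<exists>f. ?\<Phi> q f" if "q \<in> ?W" for q
  proof -
    obtain u w u' w' where q: "q = (u, w, u', w')" by (cases q)
    then have "spread u w" "spread u' w'" using that by auto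
    then show ?thesis using q by (auto elim: spread_two_transitive)
  qed
  ultimately obtain L where "\<forall>q\<in>?W. \<exists>f. ?\<Phi> q f \<and> wl f \<le> L"
    using uniform_choice[of ?W ?\<Phi>] by blast
  then have L: "\<exists>f. ?\<Phi> q f \<and> wl f \<le> L" if "q \<in> ?W" for q using that by blast
  show ?thesis
  proof (intro exI[of _ L] allI impI)
    fix u w u' w'
    assume "spread u w" "spread u' w'" "length u \<le> 4" "length w \<le> 4" "length u' \<le> 4" "length w' \<le> 4"
    then show "\<exists>f. f \<in> carrier Brin_2V \<and> carries f (cell u) (cell u') \<and> carries f (cell w) (cell w') \<and> wl f \<le> L"
      using L[of "(u, w, u', w')"] by auto
  qed
qed

text \<open>Only the first four letters of each word are looked at. If these prefixes are incomparable, an element from a finite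
  supply sends them to \<open>00\<close> and \<open>01\<close>; if they agree, it sends the common prefix to \<open>00\<close>. Either way
  the rest of the words is untouched and the total length drops. A prefix shorter than two letters may
  become longer, but by at most one letter, whereas a full prefix of four letters loses two.\<close>
lemma bring_to_corner:
  "\<exists>L. \<forall>u w. spread u w \<longrightarrow> (\<exists>g. g \<in> carrier Brin_2V \<and> carries g (cell u) E0 \<and>
    carries g (cell w) E1 \<and> wl g \<le> L * (length u + length w))"
proof -
  obtain L where L: "\<And>u w u' w'. spread u w \<Longrightarrow> spread u' w' \<Longrightarrow>
    length u \<le> 4 \<Longrightarrow> length w \<le> 4 \<Longrightarrow> length u' \<le> 4 \<Longrightarrow> length w' \<le> 4 \<Longrightarrow>
    \<exists>f. f \<in> carrier Brin_2V \<and> carries f (cell u) (cell u') \<and> carries f (cell w) (cell w') \<and> wl f \<le> L"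
    using short_words_bounded by blast
  have corner: "spread [False, False] [False, True]" by (simp add: spread_def parallel_def)
  have "\<exists>g. g \<in> carrier Brin_2V \<and> carries g (cell u) E0 \<and>
    carries g (cell w) E1 \<and> wl g \<le> L * (length u + length w)" if "spread u w" for u w
    using that
  proof (induction "length u + length w" arbitrary: u w rule: less_induct)
    case less
    have par: "u \<parallel> w" using less.prems by (simp add: spread_def)
    have reduce: ?case
      if f: "f \<in> carrier Brin_2V" "wl f \<le> L" "carries f (cell u) (cell u')" "carries f (cell w) (cell w')"
        and sm: "length u' + length w' < length u + length w" and sp: "spread u' w'" for f u' w'
    proof -
      obtain g where g: "g \<in> carrier Brin_2V" "carries g (cell u') E0" "carries g (cell w') E1"
        "wl g \<le> L * (length u' + length w')" using less.hyps[OF sm sp] by blast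
      have "wl (g \<otimes>\<^bsub>Brin_2V\<^esub> f) \<le> wl g + wl f" using g f by (intro word_length_mult)
      also have "\<dots> \<le> L * (length u' + length w') + L" using g f by simp
      also have "\<dots> = L * (length u' + length w' + 1)" by simp
      also have "\<dots> \<le> L * (length u + length w)" using sm by (intro mult_le_mono2) simp
      finally show ?thesis
        using carries_mult[OF g(1) f(1,3) g(2)] carries_mult[OF g(1) f(1,4) g(3)] g(1) f(1) by auto
    qed
    show ?case
    proof (cases "length u \<le> 4 \<and> length w \<le> 4")
      case True
      then obtain f where f: "f \<in> carrier Brin_2V" "carries f (cell u) E0" "carries f (cell w) E1" "wl f \<le> L"
        using L[OF less.prems corner] by auto
      have "L * 1 \<le> L * (length u + length w)"
        using par by (intro mult_le_mono2) (cases u; cases w; auto)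
      then have "wl f \<le> L * (length u + length w)" using f(4) by linarith
      then show ?thesis using f by blast
    next
      case False
      define u1 u2 w1 w2 where d: "u1 = take 4 u" "u2 = drop 4 u" "w1 = take 4 w" "w2 = drop 4 w"
      have uw: "u = u1 @ u2" "w = w1 @ w2" by (simp_all add: d)
      have len: "length u1 \<le> 4" "length w1 \<le> 4" "length u1 = 4 \<or> u2 = []" "length w1 = 4 \<or> w2 = []"
        "u2 \<noteq> [] \<or> w2 \<noteq> []" using False by (auto simp: d)
      show ?thesis
      proof (cases "u1 \<parallel> w1")
        case par1: True
        then have "spread u1 w1" using len by (auto simp: spread_def)
        then obtain f where f: "f \<in> carrier Brin_2V" "wl f \<le> L"
          "carries f (cell u1) (cell [False, False])" "carries f (cell w1) (cell [False, True])"
          using L[OF _ corner, of u1 w1] len by auto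
        have ne: "u1 \<noteq> []" "w1 \<noteq> []" using par1 by auto
        show ?thesis
        proof (rule reduce[OF f(1,2)])
          show "carries f (cell u) (cell ([False, False] @ u2))" "carries f (cell w) (cell ([False, True] @ w2))"
            unfolding uw cell_append using f(3,4) by (intro carries_mul; simp)+
          show "spread ([False, False] @ u2) ([False, True] @ w2)" by (simp add: spread_def parallel_def)
          show "length ([False, False] @ u2) + length ([False, True] @ w2) < length u + length w"
            using len ne by (auto simp: uw Suc_le_eq)
        qed
      next
        case False
        have "length u1 = 4" "length w1 = 4" "u1 = w1"
        proof -
          have pre: "prefix u1 w1 \<or> prefix w1 u1" using False by (auto simp: parallel_def)
          have lu: "length u1 = 4"
          proof (rule ccontr)
            assume "length u1 \<noteq> 4"
            then have "u2 = []" "length u1 < length w1" using len by auto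
            then have "prefix u1 w1" using pre prefix_length_le[of w1 u1] by auto
            then have "prefix u w" using \<open>u2 = []\<close> by (simp add: uw prefix_prefix)
            then show False using par by (simp add: parallel_def)
          qed
          have lw: "length w1 = 4"
          proof (rule ccontr)
            assume "length w1 \<noteq> 4"
            then have "w2 = []" "length w1 < length u1" using len by auto
            then have "prefix w1 u1" using pre prefix_length_le[of u1 w1] by auto
            then have "prefix w u" using \<open>w2 = []\<close> by (simp add: uw prefix_prefix)
            then show False using par by (simp add: parallel_def)
          qed
          show "length u1 = 4" "length w1 = 4" "u1 = w1" using pre lu lw by (auto simp: prefix_def)
        qed
        then have "u2 \<parallel> w2" using par unfolding uw by (simp add: parallel_def)
        obtain a p where a: "u1 = a # p" "length p = 3" using \<open>length u1 = 4\<close> by (cases u1) auto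
        have "spread u1 [\<not> a]" using a by (auto simp: spread_def parallel_def)
        then obtain f where f: "f \<in> carrier Brin_2V" "wl f \<le> L" "carries f (cell u1) (cell [False, False])"
          using L[OF _ corner, of u1 "[\<not> a]"] len by auto
        show ?thesis
        proof (rule reduce[OF f(1,2)])
          show "carries f (cell u) (cell ([False, False] @ u2))" "carries f (cell w) (cell ([False, False] @ w2))"
            unfolding uw cell_append \<open>u1 = w1\<close>[symmetric] using f(3) by (intro carries_mul; simp)+
          show "spread ([False, False] @ u2) ([False, False] @ w2)"
            using \<open>u2 \<parallel> w2\<close> by (simp add: spread_def parallel_def)
          show "length ([False, False] @ u2) + length ([False, False] @ w2) < length u + length w"
            by (simp add: uw \<open>length u1 = 4\<close> \<open>length w1 = 4\<close>)
        qed
      qed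
    qed
  qed
  then show ?thesis by blast
qed

lemma length_heap_node:
  assumes "a \<in> {n..<2 * n}"
  shows "real (length (node a)) \<le> 1 + log 2 (real n)"
proof -
  have n: "n > 0" "a > 0" "a < 2 * n" using assms by auto
  then have "(2::nat) ^ length (node a) \<le> 2 * n" using length_node[of a] by linarith
  then have "real (2 ^ length (node a)) \<le> real (2 * n)" by (simp only: of_nat_le_iff)
  then have "2 powr real (length (node a)) \<le> 2 * real n" by (simp add: powr_realpow)
  then have "real (length (node a)) \<le> log 2 (2 * real n)" using n by (simp add: le_log_iff)
  also have "\<dots> = 1 + log 2 (real n)" using n by (simp add: log_mult)
  finally show ?thesis .
qed

definition level_cost :: "nat \<Rightarrow> real" where
  "level_cost n = 1 + log 2 (real n)"

lemma level_cost_ge_1: "n > 0 \<Longrightarrow> 1 \<le> level_cost n"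
  by (simp add: level_cost_def)

text \<open>Conjugates of a fixed element cost twice the conjugator, which is logarithmic by the depth bound for the level.\<close>
lemma conjugate_bound:
  assumes "h \<in> carrier Brin_2V"
  shows "\<exists>K. \<forall>n a b. 3 \<le> n \<longrightarrow> a \<in> {n..<2 * n} \<longrightarrow> b \<in> {n..<2 * n} \<longrightarrow> a \<noteq> b \<longrightarrow>
    (\<exists>g. g \<in> carrier Brin_2V \<and> carries g (heap_cell a) E0 \<and> carries g (heap_cell b) E1 \<and>
      real (wl (inv\<^bsub>Brin_2V\<^esub> g \<otimes>\<^bsub>Brin_2V\<^esub> (h \<otimes>\<^bsub>Brin_2V\<^esub> g))) \<le> K * level_cost n)"
proof -
  obtain L where L: "\<And>u w. spread u w \<Longrightarrow> \<exists>g. g \<in> carrier Brin_2V \<and> carries g (cell u) E0 \<and>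
    carries g (cell w) E1 \<and> wl g \<le> L * (length u + length w)" using bring_to_corner by blast
  show ?thesis
  proof (intro exI[of _ "4 * real L + real (wl h)"] allI impI)
    fix n a b :: nat
    assume n: "3 \<le> n" "a \<in> {n..<2 * n}" "b \<in> {n..<2 * n}" "a \<noteq> b"
    obtain g where g: "g \<in> carrier Brin_2V" "carries g (heap_cell a) E0" "carries g (heap_cell b) E1"
      "wl g \<le> L * (length (node a) + length (node b))"
      using L[OF heap_spread[OF n(2-4,1)]] by blast
    have "wl (inv\<^bsub>Brin_2V\<^esub> g \<otimes>\<^bsub>Brin_2V\<^esub> (h \<otimes>\<^bsub>Brin_2V\<^esub> g))
        \<le> wl (inv\<^bsub>Brin_2V\<^esub> g) + wl (h \<otimes>\<^bsub>Brin_2V\<^esub> g)"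
      using g(1) assms by (intro word_length_mult) auto
    also have "\<dots> \<le> wl g + (wl h + wl g)"
      using g(1) assms by (intro add_mono word_length_inv_le word_length_mult)
    finally have "real (wl (inv\<^bsub>Brin_2V\<^esub> g \<otimes>\<^bsub>Brin_2V\<^esub> (h \<otimes>\<^bsub>Brin_2V\<^esub> g))) \<le> real (2 * wl g + wl h)"
      by simp
    also have "\<dots> \<le> real (2 * (L * (length (node a) + length (node b))) + wl h)"
      using g(4) by (simp only: of_nat_le_iff)
    also have "\<dots> = 2 * real L * (real (length (node a)) + real (length (node b))) + real (wl h)"
      by simp
    also have "\<dots> \<le> 2 * real L * (level_cost n + level_cost n) + real (wl h) * level_cost n"
      using length_heap_node[OF n(2)] length_heap_node[OF n(3)] n(1) level_cost_ge_1[of n]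
        mult_left_mono[of 1 "level_cost n" "real (wl h)"]
      by (intro add_mono mult_left_mono) (auto simp: level_cost_def)
    also have "\<dots> = (4 * real L + real (wl h)) * level_cost n" by (simp add: algebra_simps)
    finally show "\<exists>g. g \<in> carrier Brin_2V \<and> carries g (heap_cell a) E0 \<and> carries g (heap_cell b) E1 \<and>
      real (wl (inv\<^bsub>Brin_2V\<^esub> g \<otimes>\<^bsub>Brin_2V\<^esub> (h \<otimes>\<^bsub>Brin_2V\<^esub> g))) \<le> (4 * real L + real (wl h)) * level_cost n"
      using g by blast
  qed
qed

text \<open>The levels below \<open>3\<close>, where two cells may fill the square, contribute only finitely many swaps.\<close>
lemma swaps_bounded:
  "\<exists>K. \<forall>n a b. a \<in> {n..<2 * n} \<longrightarrow> b \<in> {n..<2 * n} \<longrightarrow> a \<noteq> b \<longrightarrow>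
    (\<exists>f. swaps n a b f \<and> real (wl f) \<le> K * level_cost n)"
proof -
  obtain h where h: "h \<in> carrier Brin_2V" "carries h E0 E1" "carries h E1 E0" "carries h E2 E2"
    using swap_element[OF E_partition, of E0 E1] by auto
  obtain K where K: "\<And>n a b. 3 \<le> n \<Longrightarrow> a \<in> {n..<2 * n} \<Longrightarrow> b \<in> {n..<2 * n} \<Longrightarrow> a \<noteq> b \<Longrightarrow>
    \<exists>g. g \<in> carrier Brin_2V \<and> carries g (heap_cell a) E0 \<and> carries g (heap_cell b) E1 \<and>
      real (wl (inv\<^bsub>Brin_2V\<^esub> g \<otimes>\<^bsub>Brin_2V\<^esub> (h \<otimes>\<^bsub>Brin_2V\<^esub> g))) \<le> K * level_cost n"
    using conjugate_bound[OF h(1)] by blast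
  let ?W = "{(n, a, b). a \<in> {n..<2 * n} \<and> b \<in> {n..<2 * n}} \<inter> ({..<3} \<times> {..<6} \<times> {..<6 :: nat})"
  let ?\<Phi> = "\<lambda>(n, a, b) f. swaps n a b f"
  have "\<exists>f. ?\<Phi> q f" if "q \<in> ?W" for q using that swaps_exists by auto
  then obtain L where L: "\<forall>q\<in>?W. \<exists>f. ?\<Phi> q f \<and> wl f \<le> L"
    using uniform_choice[of ?W ?\<Phi>] by auto
  show ?thesis
  proof (intro exI[of _ "max K (real L)"] allI impI)
    fix n a b :: nat assume n: "a \<in> {n..<2 * n}" "b \<in> {n..<2 * n}" "a \<noteq> b"
    then have c: "1 \<le> level_cost n" by (intro level_cost_ge_1) auto
    show "\<exists>f. swaps n a b f \<and> real (wl f) \<le> max K (real L) * level_cost n"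
    proof (cases "3 \<le> n")
      case False
      then have "(n, a, b) \<in> ?W" using n by auto
      from bspec[OF L this] obtain f where f: "swaps n a b f" "wl f \<le> L" by auto
      have "real (wl f) \<le> real L * 1" using f(2) by simp
      also have "\<dots> \<le> max K (real L) * level_cost n" using c by (intro mult_mono) auto
      finally show ?thesis using f by blast
    next
      case True
      then obtain g where g: "g \<in> carrier Brin_2V" "carries g (heap_cell a) E0" "carries g (heap_cell b) E1"
        "real (wl (inv\<^bsub>Brin_2V\<^esub> g \<otimes>\<^bsub>Brin_2V\<^esub> (h \<otimes>\<^bsub>Brin_2V\<^esub> g))) \<le> K * level_cost n"
        using K n by blast
      let ?f = "inv\<^bsub>Brin_2V\<^esub> g \<otimes>\<^bsub>Brin_2V\<^esub> (h \<otimes>\<^bsub>Brin_2V\<^esub> g)"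
      have "swaps n a b ?f" unfolding swaps_def
      proof (intro conjI ballI)
        show "?f \<in> carrier Brin_2V" using g(1) h(1) by simp
        show "carries ?f (heap_cell a) (heap_cell b)" "carries ?f (heap_cell b) (heap_cell a)"
          using conjugate_carries[OF g(1) h(1)] h g by auto
        show "carries ?f (heap_cell m) (heap_cell m)" if "m \<in> {n..<2 * n} - {a, b}" for m
          using that n by (intro conjugate_fixes[OF g(1-3) _ _ h(1,4)] heap_cells_disjoint) auto
      qed
      moreover have "K * level_cost n \<le> max K (real L) * level_cost n" using c by (intro mult_right_mono) auto
      ultimately show ?thesis using g(4) by (meson order_trans)
    qed
  qed
qed

lemma turns_bounded:
  "\<exists>K. \<forall>n>0. \<exists>f. turns n f \<and> real (wl f) \<le> K * level_cost n"
proof -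
  obtain h where h: "h \<in> carrier Brin_2V"
    "\<And>x. carries h (E0 \<odot> half Horizontal x) (E0 \<odot> half Vertical x)"
    "\<And>R. R \<in> {E0, E1, E2} \<Longrightarrow> R \<noteq> E0 \<Longrightarrow> carries h R R"
    by (rule turn_element[OF E_partition insertI1]) (rule that; simp del: half.simps cell.simps)
  have fixed: "carries h E1 E1" "carries h E2 E2" using h(3)[of E1] h(3)[of E2] by simp_all
  obtain K where K: "\<And>n a b. 3 \<le> n \<Longrightarrow> a \<in> {n..<2 * n} \<Longrightarrow> b \<in> {n..<2 * n} \<Longrightarrow> a \<noteq> b \<Longrightarrow>
    \<exists>g. g \<in> carrier Brin_2V \<and> carries g (heap_cell a) E0 \<and> carries g (heap_cell b) E1 \<and>
      real (wl (inv\<^bsub>Brin_2V\<^esub> g \<otimes>\<^bsub>Brin_2V\<^esub> (h \<otimes>\<^bsub>Brin_2V\<^esub> g))) \<le> K * level_cost n"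
    using conjugate_bound[OF h(1)] by blast
  obtain L where L: "\<forall>n\<in>{0<..<3}. \<exists>f. turns n f \<and> wl f \<le> L"
    using uniform_choice[of "{0<..<3}" turns] turns_exists by auto
  show ?thesis
  proof (intro exI[of _ "max K (real L)"] allI impI)
    fix n :: nat assume n: "0 < n"
    then have c: "1 \<le> level_cost n" by (rule level_cost_ge_1)
    show "\<exists>f. turns n f \<and> real (wl f) \<le> max K (real L) * level_cost n"
    proof (cases "3 \<le> n")
      case False
      then have "n \<in> {0<..<3}" using n by simp
      from bspec[OF L this] obtain f where f: "turns n f" "wl f \<le> L" by blast
      have "real (wl f) \<le> real L * 1" using f(2) by simp
      also have "\<dots> \<le> max K (real L) * level_cost n" using c by (intro mult_mono) auto
      finally show ?thesis using f by blast
    next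
      case True
      then obtain g where g: "g \<in> carrier Brin_2V" "carries g (heap_cell n) E0" "carries g (heap_cell (n + 1)) E1"
        "real (wl (inv\<^bsub>Brin_2V\<^esub> g \<otimes>\<^bsub>Brin_2V\<^esub> (h \<otimes>\<^bsub>Brin_2V\<^esub> g))) \<le> K * level_cost n"
        using K[of n n "n + 1"] by auto
      let ?f = "inv\<^bsub>Brin_2V\<^esub> g \<otimes>\<^bsub>Brin_2V\<^esub> (h \<otimes>\<^bsub>Brin_2V\<^esub> g)"
      have "turns n ?f" unfolding turns_def
      proof (intro conjI ballI allI)
        show "?f \<in> carrier Brin_2V" using g(1) h(1) by simp
        show "carries ?f (heap_cell n \<odot> half Horizontal x) (heap_cell n \<odot> half Vertical x)" for x
          using g(2) by (intro conjugate_carries[OF g(1) h(1) h(2)[of x]] carries_mul valid_mul valid_cell valid_half)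
        show "carries ?f (heap_cell m) (heap_cell m)" if m: "m \<in> {n<..<2 * n}" for m
        proof (cases "m = n + 1")
          case True
          then show ?thesis using g(3) by (intro conjugate_carries[OF g(1) h(1) fixed(1)]) auto
        next
          case False
          then show ?thesis
            using m True by (intro conjugate_fixes[OF g(1-3) _ _ h(1) fixed(2)] heap_cells_disjoint[of _ n]) auto
        qed
      qed
      moreover have "K * level_cost n \<le> max K (real L) * level_cost n" using c by (intro mult_right_mono) auto
      ultimately show ?thesis using g(4) by (meson order_trans)
    qed
  qed
qed

end

section \<open>The upper bound for the word length\<close>

context generated_2V
begin

text \<open>Let \<open>f0\<close> carry the tree without its last caret to the level \<open>n\<close>, and the leaf \<open>R\<close> that is to be split to
  the cell \<open>b\<close>. The element \<open>t\<close> moves \<open>b\<close> to \<open>n\<close>, and \<open>r\<close> makes the cut vertical. The halves of \<open>R\<close> then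
  occupy the nodes \<open>2 n\<close> and \<open>2 n + 1\<close>, and the other leaves keep nodes between \<open>n + 1\<close> and \<open>2 n - 1\<close>.\<close>
lemma tree_to_heap:
  "\<exists>K\<ge>0. \<forall>T. \<exists>f. f \<in> carrier Brin_2V \<and>
    (\<forall>R\<in>leaves T. \<exists>m\<in>{num_leaves T..<2 * num_leaves T}. carries f R (heap_cell m)) \<and>
    real (wl f) \<le> K * (real (num_leaves T) * level_cost (num_leaves T))"
proof -
  obtain K1 where K1: "\<And>n a b. a \<in> {n..<2 * n} \<Longrightarrow> b \<in> {n..<2 * n} \<Longrightarrow> a \<noteq> b \<Longrightarrow>
    \<exists>f. swaps n a b f \<and> real (wl f) \<le> K1 * level_cost n" using swaps_bounded by blast
  obtain K2 where K2: "\<And>n. n > 0 \<Longrightarrow> \<exists>f. turns n f \<and> real (wl f) \<le> K2 * level_cost n"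
    using turns_bounded by blast
  define K where "K = max 0 K1 + max 0 K2"
  have Kge: "K \<ge> 0" by (simp add: K_def)
  have "\<exists>f. f \<in> carrier Brin_2V \<and>
    (\<forall>R\<in>leaves T. \<exists>m\<in>{n..<2 * n}. carries f R (heap_cell m)) \<and>
    real (wl f) \<le> K * (real n * level_cost n)" if "num_leaves T = n" for T n
    using that
  proof (induction n arbitrary: T)
    case 0
    then show ?case by (simp add: num_leaves_eq)
  next
    case (Suc n)
    show ?case
    proof (cases "T = Leaf")
      case True
      then have "n = 0" using Suc.prems by simp
      then have "{Suc n..<2 * Suc n} = {1}" by auto
      then show ?thesis
        using True Kge level_cost_ge_1[of 1] carries_one[of root]
        by (intro exI[of _ "\<one>\<^bsub>Brin_2V\<^esub>"]) (auto simp: leaves_Leaf node_1 \<open>n = 0\<close>)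
    next
      case False
      then obtain T0 R c where T0: "num_leaves T = Suc (num_leaves T0)" "R \<in> leaves T0"
        "leaves T \<subseteq> (leaves T0 - {R}) \<union> range (\<lambda>x. R \<odot> half c x)" using remove_caret by blast
      then have n: "num_leaves T0 = n" "n > 0" using Suc.prems num_leaves_eq[of T0] by auto
      obtain f0 where f0: "f0 \<in> carrier Brin_2V"
        "\<And>R. R \<in> leaves T0 \<Longrightarrow> \<exists>m\<in>{n..<2 * n}. carries f0 R (heap_cell m)"
        "real (wl f0) \<le> K * (real n * level_cost n)" using Suc.IH[OF n(1)] by blast
      have v: "valid R" if "R \<in> leaves T0" for R using that leaves_partition partition_valid by blast
      have c1: "1 \<le> level_cost n" using n(2) by (rule level_cost_ge_1)
      obtain b where b: "b \<in> {n..<2 * n}" "carries f0 R (heap_cell b)" using f0(2) T0(2) by blast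
      have "\<exists>t. t \<in> carrier Brin_2V \<and> carries t (heap_cell b) (heap_cell n) \<and>
        (\<forall>m\<in>{n..<2 * n} - {b}. \<exists>m'\<in>{n<..<2 * n}. carries t (heap_cell m) (heap_cell m')) \<and>
        real (wl t) \<le> max 0 K1 * level_cost n"
      proof (cases "b = n")
        case True
        have "\<exists>m'\<in>{n<..<2 * n}. carries \<one>\<^bsub>Brin_2V\<^esub> (heap_cell m) (heap_cell m')"
          if "m \<in> {n..<2 * n} - {b}" for m
          using that True carries_one by (intro bexI[of _ m]) auto
        then show ?thesis using True carries_one c1
          by (intro exI[of _ "\<one>\<^bsub>Brin_2V\<^esub>"]) auto
      next
        case False
        then obtain t where t: "swaps n b n t" "real (wl t) \<le> K1 * level_cost n"
          using K1[of b n n] b n by auto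
        have "\<exists>m'\<in>{n<..<2 * n}. carries t (heap_cell m) (heap_cell m')" if m: "m \<in> {n..<2 * n} - {b}" for m
        proof (cases "m = n")
          case True
          then show ?thesis using t(1) b(1) \<open>b \<noteq> n\<close> unfolding swaps_def by (intro bexI[of _ b]) auto
        next
          case False
          then show ?thesis using t(1) m unfolding swaps_def by (intro bexI[of _ m]) auto
        qed
        moreover have "K1 * level_cost n \<le> max 0 K1 * level_cost n" using c1 by (intro mult_right_mono) auto
        ultimately show ?thesis using t unfolding swaps_def by (intro exI[of _ t]) auto
      qed
      then obtain t where t: "t \<in> carrier Brin_2V" "carries t (heap_cell b) (heap_cell n)"
        "\<And>m. m \<in> {n..<2 * n} - {b} \<Longrightarrow> \<exists>m'\<in>{n<..<2 * n}. carries t (heap_cell m) (heap_cell m')"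
        "real (wl t) \<le> max 0 K1 * level_cost n" by blast
      have "\<exists>r. r \<in> carrier Brin_2V \<and>
        (\<forall>x. carries r (heap_cell n \<odot> half c x) (heap_cell n \<odot> half Vertical x)) \<and>
        (\<forall>m\<in>{n<..<2 * n}. carries r (heap_cell m) (heap_cell m)) \<and>
        real (wl r) \<le> max 0 K2 * level_cost n"
      proof (cases c)
        case Vertical
        then show ?thesis using carries_one c1 by (intro exI[of _ "\<one>\<^bsub>Brin_2V\<^esub>"]) (auto simp: valid_mul)
      next
        case Horizontal
        obtain r where r: "turns n r" "real (wl r) \<le> K2 * level_cost n" using K2 n by blast
        moreover have "K2 * level_cost n \<le> max 0 K2 * level_cost n" using c1 by (intro mult_right_mono) auto
        ultimately show ?thesis using Horizontal unfolding turns_def by (intro exI[of _ r]) auto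
      qed
      then obtain r where r: "r \<in> carrier Brin_2V"
        "\<And>x. carries r (heap_cell n \<odot> half c x) (heap_cell n \<odot> half Vertical x)"
        "\<And>m. m \<in> {n<..<2 * n} \<Longrightarrow> carries r (heap_cell m) (heap_cell m)"
        "real (wl r) \<le> max 0 K2 * level_cost n" by blast
      define f1 where "f1 = t \<otimes>\<^bsub>Brin_2V\<^esub> f0"
      define f where "f = r \<otimes>\<^bsub>Brin_2V\<^esub> f1"
      have f1: "f1 \<in> carrier Brin_2V" "carries f1 R (heap_cell n)"
        using t f0(1) b v[OF T0(2)] by (auto simp: f1_def intro: carries_mult)
      have f: "f \<in> carrier Brin_2V" using f1 r by (simp add: f_def)
      have "\<exists>m\<in>{Suc n..<2 * Suc n}. carries f Y (heap_cell m)" if Y: "Y \<in> leaves T" for Y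
      proof (cases "Y \<in> leaves T0 - {R}")
        case True
        then obtain m where m: "m \<in> {n..<2 * n}" "carries f0 Y (heap_cell m)" using f0(2) by blast
        have "m \<noteq> b"
        proof
          assume "m = b"
          then have "Y = R" using carries_inj[OF f0(1) _ b(2)] m(2) v True T0(2) by blast
          then show False using True by simp
        qed
        then obtain m' where m': "m' \<in> {n<..<2 * n}" "carries t (heap_cell m) (heap_cell m')"
          using t(3)[of m] m(1) by blast
        have vY: "valid Y" using True v by blast
        have "carries f1 Y (heap_cell m')" unfolding f1_def by (rule carries_mult[OF t(1) f0(1) m(2) m'(2) vY])
        then have "carries f Y (heap_cell m')" unfolding f_def
          by (rule carries_mult[OF r(1) f1(1) _ r(3)[OF m'(1)] vY])
        then show ?thesis using m'(1) by (intro bexI[of _ m']) auto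
      next
        case False
        then obtain x where x: "Y = R \<odot> half c x" using T0(3) Y by blast
        have "carries f1 Y (heap_cell n \<odot> half c x)" unfolding x using f1(2) by (intro carries_mul valid_half)
        then have "carries f Y (heap_cell n \<odot> half Vertical x)" unfolding f_def
          by (rule carries_mult[OF r(1) f1(1) _ r(2)]) (simp add: x valid_mul v T0(2))
        moreover have "heap_cell n \<odot> half Vertical x = heap_cell (2 * n + of_bool x)"
          using heap_cell_double[OF n(2)] by (cases x) auto
        ultimately show ?thesis using n(2) by (intro bexI[of _ "2 * n + of_bool x"]) auto
      qed
      moreover have "real (wl f) \<le> K * (real (Suc n) * level_cost (Suc n))"
      proof -
        have "wl f \<le> wl r + wl f1" unfolding f_def using r f1 by (intro word_length_mult)
        moreover have "wl f1 \<le> wl t + wl f0" unfolding f1_def using t f0 by (intro word_length_mult)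
        ultimately have "real (wl f) \<le> real (wl r) + real (wl t) + real (wl f0)" by linarith
        also have "\<dots> \<le> K * level_cost n + K * (real n * level_cost n)"
          using r(4) t(4) f0(3) by (simp add: K_def algebra_simps)
        also have "\<dots> = K * (real (Suc n) * level_cost n)" by (simp add: algebra_simps)
        also have "\<dots> \<le> K * (real (Suc n) * level_cost (Suc n))"
          using n(2) Kge by (intro mult_left_mono) (auto simp: level_cost_def)
        finally show ?thesis .
      qed
      ultimately show ?thesis using f by blast
    qed
  qed
  then show ?thesis using Kge by blast
qed

text \<open>A swap puts one more cell into place without disturbing those already fixed, so the number of
  displaced cells decreases.\<close>
lemma heap_permutation_length:
  "\<exists>K\<ge>0. \<forall>n>0. \<forall>y\<in>carrier Brin_2V.
    (\<forall>m\<in>{n..<2 * n}. \<exists>m'\<in>{n..<2 * n}. carries y (heap_cell m) (heap_cell m')) \<longrightarrow>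
    real (wl y) \<le> K * (real n * level_cost n)"
proof -
  obtain K1 where K1: "\<And>n a b. a \<in> {n..<2 * n} \<Longrightarrow> b \<in> {n..<2 * n} \<Longrightarrow> a \<noteq> b \<Longrightarrow>
    \<exists>f. swaps n a b f \<and> real (wl f) \<le> K1 * level_cost n" using swaps_bounded by blast
  define K where "K = max 0 K1"
  \<comment> \<open>the cells that \<open>y\<close> displaces\<close>
  define M where "M n y = {m\<in>{n..<2 * n}. \<not> carries y (heap_cell m) (heap_cell m)}" for n y
  have main: "real (wl y) \<le> K * (real (card (M n y)) * level_cost n)"
    if n: "n > 0" and y: "y \<in> carrier Brin_2V"
      "\<forall>m\<in>{n..<2 * n}. \<exists>m'\<in>{n..<2 * n}. carries y (heap_cell m) (heap_cell m')" for n y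
    using y
  proof (induction "card (M n y)" arbitrary: y rule: less_induct)
    case less
    have c1: "1 \<le> level_cost n" using n by (rule level_cost_ge_1)
    show ?case
    proof (cases "M n y = {}")
      case True
      then have "carries y R R \<and> carries (\<one>\<^bsub>Brin_2V\<^esub>) R R" if "R \<in> heap_level n" for R
        using that carries_one by (auto simp: M_def heap_level_def)
      then have "y = \<one>\<^bsub>Brin_2V\<^esub>"
        using less.prems(1) by (intro carrier_eqI[OF _ _ heap_level(1)[OF n]]) auto
      then show ?thesis using True by simp
    next
      case False
      then obtain a where a: "a \<in> {n..<2 * n}" "\<not> carries y (heap_cell a) (heap_cell a)" by (auto simp: M_def)
      then obtain b where b: "b \<in> {n..<2 * n}" "carries y (heap_cell a) (heap_cell b)" using less.prems(2) by blast
      then have "a \<noteq> b" using a by blast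
      then obtain t where t: "swaps n a b t" "real (wl t) \<le> K1 * level_cost n" using K1 a(1) b(1) by blast
      then have tc: "t \<in> carrier Brin_2V" by (simp add: swaps_def)
      let ?z = "t \<otimes>\<^bsub>Brin_2V\<^esub> y"
      have z: "?z \<in> carrier Brin_2V" using tc less.prems(1) by simp
      have lev: "\<exists>m'\<in>{n..<2 * n}. carries t (heap_cell m) (heap_cell m')" if "m \<in> {n..<2 * n}" for m
      proof (cases "m = a \<or> m = b")
        case True
        then show ?thesis using t(1) a(1) b(1) unfolding swaps_def by auto
      next
        case False
        then show ?thesis using t(1) that unfolding swaps_def by (intro bexI[of _ m]) auto
      qed
      have lev': "\<forall>m\<in>{n..<2 * n}. \<exists>m'\<in>{n..<2 * n}. carries ?z (heap_cell m) (heap_cell m')"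
      proof
        fix m assume m: "m \<in> {n..<2 * n}"
        then obtain m' where m': "m' \<in> {n..<2 * n}" "carries y (heap_cell m) (heap_cell m')"
          using less.prems(2) by blast
        then obtain m'' where m'': "m'' \<in> {n..<2 * n}" "carries t (heap_cell m') (heap_cell m'')"
          using lev by blast
        show "\<exists>m'\<in>{n..<2 * n}. carries ?z (heap_cell m) (heap_cell m')"
          using carries_mult[OF tc less.prems(1) m'(2) m''(2) valid_cell] m''(1)
          by (intro bexI[of _ m''])
      qed
      have "M n ?z \<subset> M n y"
      proof
        show "M n ?z \<subseteq> M n y"
        proof
          fix m assume m: "m \<in> M n ?z"
          have "\<not> carries y (heap_cell m) (heap_cell m)"
          proof
            assume fix_m: "carries y (heap_cell m) (heap_cell m)"
            have "m \<noteq> a" using fix_m a(2) by blast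
            moreover have "m \<noteq> b"
            proof
              assume "m = b"
              then have "heap_cell m = heap_cell a"
                using carries_inj[OF less.prems(1) fix_m, of "heap_cell a"] b(2) by simp
              then show False
                using inj_onD[OF heap_level(3)[OF n], of b a] a(1) b(1) \<open>m = b\<close> \<open>a \<noteq> b\<close> by simp
            qed
            ultimately have "carries t (heap_cell m) (heap_cell m)" using t(1) m by (auto simp: swaps_def M_def)
            then have "carries ?z (heap_cell m) (heap_cell m)"
              using carries_mult[OF tc less.prems(1) fix_m] by simp
            then show False using m by (simp add: M_def)
          qed
          then show "m \<in> M n y" using m by (simp add: M_def)
        qed
        have "carries ?z (heap_cell a) (heap_cell a)"
          using carries_mult[OF tc less.prems(1) b(2)] t(1) by (simp add: swaps_def)
        then show "M n ?z \<noteq> M n y" using a by (auto simp: M_def)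
      qed
      then have card: "card (M n ?z) < card (M n y)" by (intro psubset_card_mono) (simp add: M_def)
      have "y = inv\<^bsub>Brin_2V\<^esub> t \<otimes>\<^bsub>Brin_2V\<^esub> ?z" using tc less.prems(1) by (simp add: m_assoc[symmetric])
      then have "wl y \<le> wl (inv\<^bsub>Brin_2V\<^esub> t) + wl ?z" using word_length_mult[of "inv\<^bsub>Brin_2V\<^esub> t" ?z] tc z by simp
      then have "real (wl y) \<le> real (wl t) + real (wl ?z)" using word_length_inv_le[OF tc] by linarith
      also have "\<dots> \<le> K * level_cost n + K * (real (card (M n ?z)) * level_cost n)"
      proof (rule add_mono)
        have "K1 * level_cost n \<le> K * level_cost n" using c1 by (intro mult_right_mono) (auto simp: K_def)
        then show "real (wl t) \<le> K * level_cost n" using t(2) by linarith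
      qed (rule less.hyps[OF card z lev'])
      also have "\<dots> = K * (real (card (M n ?z) + 1) * level_cost n)" by (simp add: algebra_simps)
      also have "\<dots> \<le> K * (real (card (M n y)) * level_cost n)"
        using card c1 by (intro mult_left_mono mult_right_mono) (auto simp: K_def)
      finally show ?thesis .
    qed
  qed
  show ?thesis
  proof (intro exI[of _ K] conjI allI ballI impI)
    show "K \<ge> 0" by (simp add: K_def)
    fix n :: nat and y assume n: "n > 0" and y: "y \<in> carrier Brin_2V"
      "\<forall>m\<in>{n..<2 * n}. \<exists>m'\<in>{n..<2 * n}. carries y (heap_cell m) (heap_cell m')"
    have "card (M n y) \<le> card {n..<2 * n}" unfolding M_def by (intro card_mono) auto
    then have "K * (real (card (M n y)) * level_cost n) \<le> K * (real n * level_cost n)"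
      using level_cost_ge_1[OF n] by (intro mult_left_mono mult_right_mono) (auto simp: K_def)
    then show "real (wl y) \<le> K * (real n * level_cost n)" using main[OF n y] by linarith
  qed
qed

text \<open>With \<open>f\<close> and \<open>f'\<close> carrying the domain and the range partition of \<open>x\<close> to the same level, the
  element \<open>f' x f\<^sup>-\<^sup>1\<close> permutes the cells of that level.\<close>
lemma word_length_pieces:
  "\<exists>K\<ge>0. \<forall>x P. pieces P x \<longrightarrow> real (wl x) \<le> K * (real (card P) * level_cost (card P))"
proof -
  obtain K1 where K1: "K1 \<ge> 0" "\<And>T. \<exists>f. f \<in> carrier Brin_2V \<and>
    (\<forall>R\<in>leaves T. \<exists>m\<in>{num_leaves T..<2 * num_leaves T}. carries f R (heap_cell m)) \<and>
    real (wl f) \<le> K1 * (real (num_leaves T) * level_cost (num_leaves T))" using tree_to_heap by blast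
  obtain K2 where K2: "K2 \<ge> 0" "\<And>n y. n > 0 \<Longrightarrow> y \<in> carrier Brin_2V \<Longrightarrow>
    \<forall>m\<in>{n..<2 * n}. \<exists>m'\<in>{n..<2 * n}. carries y (heap_cell m) (heap_cell m') \<Longrightarrow>
    real (wl y) \<le> K2 * (real n * level_cost n)" using heap_permutation_length by blast
  have heap: "\<exists>f. f \<in> carrier Brin_2V \<and>
      (\<forall>R\<in>P. \<exists>m\<in>{card P..<2 * card P}. carries f R (heap_cell m)) \<and>
      real (wl f) \<le> K1 * (real (card P) * level_cost (card P))" if P: "dyadic_partition P" for P
  proof -
    obtain T where "leaves T = P" using P by (rule partition_tree)
    then show ?thesis using K1(2)[of T] leaves_partition(2)[of T] by simp
  qed
  show ?thesis
  proof (intro exI[of _ "2 * K1 + K2"] conjI allI impI)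
    show "0 \<le> 2 * K1 + K2" using K1 K2 by simp
    fix x P assume P: "pieces P x"
    then have dp: "dyadic_partition P" by (simp add: pieces_def)
    have x: "x \<in> carrier Brin_2V" using P carrier_iff_pieces by blast
    obtain \<phi> where \<phi>: "\<And>R. R \<in> P \<Longrightarrow> carries x R (\<phi> R)" "inj_on \<phi> P" "dyadic_partition (\<phi> ` P)"
      using P by (rule pieces_image) blast
    define n where "n = card P"
    have n: "n > 0" "card (\<phi> ` P) = n" using partition_card_pos[OF dp] \<phi>(2) by (auto simp: n_def card_image)
    obtain f where f: "f \<in> carrier Brin_2V" "\<And>R. R \<in> P \<Longrightarrow> \<exists>m\<in>{n..<2 * n}. carries f R (heap_cell m)"
      "real (wl f) \<le> K1 * (real n * level_cost n)" using heap[OF dp] unfolding n_def by blast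
    obtain f' where f': "f' \<in> carrier Brin_2V" "\<And>R. R \<in> \<phi> ` P \<Longrightarrow> \<exists>m\<in>{n..<2 * n}. carries f' R (heap_cell m)"
      "real (wl f') \<le> K1 * (real n * level_cost n)" using heap[OF \<phi>(3)] unfolding n(2) by blast
    have v: "valid R" if "R \<in> P" for R using that dp partition_valid by blast
    let ?y = "f' \<otimes>\<^bsub>Brin_2V\<^esub> (x \<otimes>\<^bsub>Brin_2V\<^esub> inv\<^bsub>Brin_2V\<^esub> f)"
    have y: "?y \<in> carrier Brin_2V" using x f(1) f'(1) by simp
    obtain \<mu> where \<mu>: "\<And>R. R \<in> P \<Longrightarrow> \<mu> R \<in> {n..<2 * n}" "\<And>R. R \<in> P \<Longrightarrow> carries f R (heap_cell (\<mu> R))"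
      using f(2) by metis
    have "inj_on \<mu> P"
      using carries_inj[OF f(1)] \<mu>(2) v by (intro inj_onI) metis
    then have "\<mu> ` P = {n..<2 * n}"
      using \<mu>(1) by (intro card_subset_eq) (auto simp: card_image n_def)
    have "\<exists>m'\<in>{n..<2 * n}. carries ?y (heap_cell m) (heap_cell m')" if m: "m \<in> {n..<2 * n}" for m
    proof -
      obtain R where R: "R \<in> P" "m = \<mu> R" using m \<open>\<mu> ` P = {n..<2 * n}\<close> by blast
      have "carries (inv\<^bsub>Brin_2V\<^esub> f) (heap_cell m) R" using carries_inv[OF f(1) \<mu>(2)] R v by blast
      then have 1: "carries (x \<otimes>\<^bsub>Brin_2V\<^esub> inv\<^bsub>Brin_2V\<^esub> f) (heap_cell m) (\<phi> R)"
        using x f(1) \<phi>(1)[OF R(1)] by (intro carries_mult[of _ _ _ R]) auto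
      obtain m' where m': "m' \<in> {n..<2 * n}" "carries f' (\<phi> R) (heap_cell m')" using f'(2) R(1) by blast
      have "x \<otimes>\<^bsub>Brin_2V\<^esub> inv\<^bsub>Brin_2V\<^esub> f \<in> carrier Brin_2V" using x f(1) by simp
      then show ?thesis using carries_mult[OF f'(1) _ 1 m'(2) valid_cell] m'(1)
        by (intro bexI[of _ m'])
    qed
    then have wy: "real (wl ?y) \<le> K2 * (real n * level_cost n)" using K2(2)[OF n(1) y] by blast
    have "x = inv\<^bsub>Brin_2V\<^esub> f' \<otimes>\<^bsub>Brin_2V\<^esub> (?y \<otimes>\<^bsub>Brin_2V\<^esub> f)"
    proof -
      have "?y \<otimes>\<^bsub>Brin_2V\<^esub> f = f' \<otimes>\<^bsub>Brin_2V\<^esub> x"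
        using x f(1) f'(1) by (simp add: m_assoc)
      then show ?thesis using x f'(1) by (simp add: m_assoc[symmetric])
    qed
    then have "wl x \<le> wl (inv\<^bsub>Brin_2V\<^esub> f') + wl (?y \<otimes>\<^bsub>Brin_2V\<^esub> f)"
      using word_length_mult[of "inv\<^bsub>Brin_2V\<^esub> f'" "?y \<otimes>\<^bsub>Brin_2V\<^esub> f"] y f(1) f'(1) by simp
    then have "real (wl x) \<le> real (wl f') + (real (wl ?y) + real (wl f))"
      using word_length_mult[OF y f(1)] word_length_inv_le[OF f'(1)] by linarith
    also have "\<dots> \<le> (2 * K1 + K2) * (real n * level_cost n)" using f(3) f'(3) wy by (simp add: algebra_simps)
    finally show "real (wl x) \<le> (2 * K1 + K2) * (real (card P) * level_cost (card P))" by (simp add: n_def)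
  qed
qed

text \<open>The passage from leaves to carets. For \<open>N \<ge> 2\<close> the factor \<open>N + 1\<close> is at most \<open>2 N\<close>, the cost is at
  most \<open>3 log 2 N\<close>, and \<open>ln 2\<close> is at least \<open>1/2\<close>, which multiply to \<open>12\<close>.\<close>
lemma level_cost_bound:
  "real (Suc N) * level_cost (Suc N) \<le> 12 * (real N * ln (real N) + 1)"
proof (cases "N \<ge> 2")
  case False
  then consider "N = 0" | "N = 1" by linarith
  then show ?thesis by cases (auto simp: level_cost_def)
next
  case True
  have 1: "1 \<le> log 2 (real N)" using True by (simp add: le_log_iff)
  have "log 2 (real (Suc N)) \<le> log 2 (2 * real N)" using True by (intro log_mono) auto
  also have "\<dots> = 1 + log 2 (real N)" using True by (simp add: log_mult)
  finally have "level_cost (Suc N) \<le> 3 * log 2 (real N)" using 1 by (simp add: level_cost_def)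
  then have "real (Suc N) * level_cost (Suc N) \<le> (2 * real N) * (3 * log 2 (real N))"
    using True level_cost_ge_1[of "Suc N"] by (intro mult_mono) auto
  also have "\<dots> = 6 * real N * (ln (real N) / ln 2)" by (simp add: log_def)
  also have "ln (real N) / ln 2 \<le> ln (real N) / (1/2)"
  proof (intro divide_left_mono)
    have "exp (1/2) ^ 2 \<le> (2::real) ^ 2" using exp_le by (simp flip: exp_of_nat_mult)
    then have "exp (1/2) \<le> (2::real)" by (rule power2_le_imp_le) simp
    then show "1/2 \<le> ln (2::real)" using ln_ge_iff[of 2 "1/2"] by simp
  qed (use True in auto)
  finally show ?thesis using True by (simp add: mult_left_mono algebra_simps)
qed

lemma word_length_upper_bound:
  "\<exists>C>0. \<forall>x\<in>carrier Brin_2V.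
    real (wl x) \<le> C * (real (min_carets x) * ln (real (min_carets x)) + 1)"
proof -
  obtain K where K: "K \<ge> 0" "\<And>x P. pieces P x \<Longrightarrow> real (wl x) \<le> K * (real (card P) * level_cost (card P))"
    using word_length_pieces by blast
  have "real (wl x) \<le> (12 * K + 1) * (real (min_carets x) * ln (real (min_carets x)) + 1)"
    if x: "x \<in> carrier Brin_2V" for x
  proof -
    let ?N = "min_carets x"
    obtain P where P: "pieces P x" "card P = Suc ?N" using x by (rule min_carets_attained)
    have "real ?N * ln (real ?N) \<ge> 0" by (cases "?N = 0") auto
    have "real (wl x) \<le> K * (real (Suc ?N) * level_cost (Suc ?N))" using K(2)[OF P(1)] P(2) by simp
    also have "\<dots> \<le> K * (12 * (real ?N * ln (real ?N) + 1))" using K(1) level_cost_bound by (rule mult_left_mono[rotated])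
    also have "\<dots> \<le> (12 * K + 1) * (real ?N * ln (real ?N) + 1)"
      using \<open>real ?N * ln (real ?N) \<ge> 0\<close> by (simp add: algebra_simps)
    finally show ?thesis .
  qed
  then show ?thesis using K(1) by (intro exI[of _ "12 * K + 1"]) auto
qed

section \<open>The four bounds\<close>

lemma carets_lower_bound:
  "\<exists>C>0. \<forall>x\<in>carrier Brin_2V. x \<noteq> \<one>\<^bsub>Brin_2V\<^esub> \<longrightarrow> ln (real (min_carets x)) \<le> C * real (wl x)"
proof -
  obtain M :: nat where M: "M > 1" "\<And>x. x \<in> carrier Brin_2V \<Longrightarrow> Suc (min_carets x) \<le> M ^ wl x"
    using word_exponential_carets[OF finitely_generated_group_axioms] by blast
  show ?thesis
  proof (intro exI[of _ "ln (real M)"] conjI ballI impI)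
    show "ln (real M) > 0" using M(1) by simp
    fix x assume x: "x \<in> carrier Brin_2V" "x \<noteq> \<one>\<^bsub>Brin_2V\<^esub>"
    have "min_carets x \<le> M ^ wl x" using M(2)[OF x(1)] by simp
    then have "real (min_carets x) \<le> real (M ^ wl x)" by (simp only: of_nat_le_iff)
    then have "ln (real (min_carets x)) \<le> ln (real (M ^ wl x))"
      using min_carets_pos[OF x] by (intro ln_mono) auto
    also have "\<dots> = ln (real M) * real (wl x)" using M(1) by (simp add: ln_realpow)
    finally show "ln (real (min_carets x)) \<le> ln (real M) * real (wl x)" .
  qed
qed

text \<open>The powers start at the exponent \<open>2\<close>, since the baker's map itself has one caret and logarithm \<open>0\<close>.\<close>
lemma lower_bound_sharp:
  "\<exists>C>0. \<exists>x :: nat \<Rightarrow> (real \<times> real \<Rightarrow> real \<times> real). (\<forall>k. x k \<in> carrier Brin_2V) \<and>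
    filterlim (\<lambda>k. min_carets (x k)) at_top sequentially \<and>
    (\<forall>k. real (wl (x k)) \<le> C * ln (real (min_carets (x k))))"
proof -
  obtain b where b: "b \<in> carrier Brin_2V"
    "\<And>k. 2 ^ k \<le> Suc (min_carets (b [^]\<^bsub>Brin_2V\<^esub> (k::nat)))" using exponentially_distorted by blast
  define x where "x k = b [^]\<^bsub>Brin_2V\<^esub> (k + 2)" for k :: nat
  have N: "2 ^ (k + 1) \<le> min_carets (x k)" for k
  proof -
    have "2 ^ (k + 2) \<le> Suc (min_carets (x k))" using b(2)[of "k + 2"] by (simp add: x_def)
    moreover have "(1::nat) \<le> 2 ^ (k + 1)" by simp
    ultimately show ?thesis by (simp add: power_add)
  qed
  show ?thesis
  proof (intro exI[of _ "2 * (real (wl b) + 1) / ln 2"] exI[of _ x] conjI allI)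
    show "2 * (real (wl b) + 1) / ln 2 > 0" by simp
    show "x k \<in> carrier Brin_2V" for k using b(1) by (simp add: x_def)
    show "filterlim (\<lambda>k. min_carets (x k)) at_top sequentially"
    proof (rule filterlim_at_top_mono[OF filterlim_ident])
      have "k \<le> min_carets (x k)" for k
        using N[of k] less_exp[of "k + 1"] by linarith
      then show "\<forall>\<^sub>F k in sequentially. k \<le> min_carets (x k)" by simp
    qed
    fix k
    have "real (2 ^ (k + 1)) \<le> real (min_carets (x k))" using N by (simp only: of_nat_le_iff)
    then have "ln (2 ^ (k + 1)) \<le> ln (real (min_carets (x k)))" by (intro ln_mono) auto
    moreover have "ln (2 ^ (k + 1)) = real (k + 1) * ln (2::real)" by (rule ln_realpow)
    ultimately have ln: "real (k + 1) * ln 2 \<le> ln (real (min_carets (x k)))" by simp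
    have "real (wl (x k)) \<le> real ((k + 2) * wl b)" unfolding x_def using word_length_pow[OF b(1), of "k + 2"] by (simp only: of_nat_le_iff)
    also have "\<dots> \<le> (2 * real (k + 1)) * (real (wl b) + 1)" unfolding of_nat_mult by (intro mult_mono) auto
    also have "\<dots> = (2 * (real (wl b) + 1) / ln 2) * (real (k + 1) * ln 2)"
      by (simp add: field_simps)
    also have "\<dots> \<le> (2 * (real (wl b) + 1) / ln 2) * ln (real (min_carets (x k)))"
      using ln by (intro mult_left_mono) auto
    finally show "real (wl (x k)) \<le> (2 * (real (wl b) + 1) / ln 2) * ln (real (min_carets (x k)))" .
  qed
qed

text \<open>Counting only gives elements with fewer than \<open>n\<close> carets. That their caret numbers tend to infinity
  follows from the upper bound: their word lengths do.\<close>
lemma upper_bound_sharp: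
  "\<exists>c>0. \<exists>y :: nat \<Rightarrow> (real \<times> real \<Rightarrow> real \<times> real). (\<forall>k. y k \<in> carrier Brin_2V) \<and>
    filterlim (\<lambda>k. min_carets (y k)) at_top sequentially \<and>
    (\<forall>k. real (wl (y k)) \<ge> c * (real (min_carets (y k)) * ln (real (min_carets (y k)))))"
proof -
  obtain C where C: "C > 0" "\<And>x. x \<in> carrier Brin_2V \<Longrightarrow>
    real (wl x) \<le> C * (real (min_carets x) * ln (real (min_carets x)) + 1)"
    using word_length_upper_bound by blast
  define B where "B = card (symmetrized Brin_2V S) + 2"
  define c where "c = 1 / (2 * ln (real B))"
  have B: "ln (real B) > 0" by (simp add: B_def)
  then have c: "c > 0" by (simp add: c_def)
  have mono: "real m * ln (real m) \<le> real n * ln (real n)" if "m \<le> n" for m n :: nat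
    using that by (cases "m = 0"; cases "n = 0") (auto intro!: mult_mono)
  have "\<exists>y. y \<in> carrier Brin_2V \<and> min_carets y < n \<and> c * (real n * ln (real n)) \<le> real (wl y)" if n: "n > 0" for n
  proof -
    obtain y where y: "y \<in> carrier Brin_2V" "min_carets y < n"
      "fact n \<le> (card (symmetrized Brin_2V S) + 1) ^ wl y"
      using many_elements[OF finitely_generated_group_axioms n] by blast
    have "fact n \<le> B ^ wl y"
      using y(3) power_mono[of "card (symmetrized Brin_2V S) + 1" B "wl y"] by (simp add: B_def)
    then have "real (fact n) \<le> real (B ^ wl y)" by (simp only: of_nat_le_iff)
    then have "ln (fact n) \<le> ln (real B ^ wl y)" by (intro ln_mono) auto
    also have "\<dots> = real (wl y) * ln (real B)" by (simp add: ln_realpow B_def)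
    finally have "real n * ln (real n) \<le> 2 * (real (wl y) * ln (real B))" using ln_fact_ge[of n] by linarith
    then have "c * (real n * ln (real n)) \<le> real (wl y)" using B by (simp add: c_def field_simps)
    then show ?thesis using y by blast
  qed
  then obtain z where z: "\<And>n. n > 0 \<Longrightarrow> z n \<in> carrier Brin_2V" "\<And>n. n > 0 \<Longrightarrow> min_carets (z n) < n"
    "\<And>n. n > 0 \<Longrightarrow> c * (real n * ln (real n)) \<le> real (wl (z n))" by metis
  define y where "y k = z (Suc k)" for k
  show ?thesis
  proof (intro exI[of _ c] exI[of _ y] conjI allI)
    show "c > 0" by (fact c)
    show "y k \<in> carrier Brin_2V" for k using z(1) by (simp add: y_def)
    show "c * (real (min_carets (y k)) * ln (real (min_carets (y k)))) \<le> real (wl (y k))" for k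
    proof -
      have "c * (real (min_carets (y k)) * ln (real (min_carets (y k)))) \<le> c * (real (Suc k) * ln (real (Suc k)))"
        using z(2)[of "Suc k"] c by (intro mult_left_mono mono) (auto simp: y_def)
      also have "\<dots> \<le> real (wl (y k))" using z(3)[of "Suc k"] by (simp add: y_def)
      finally show ?thesis .
    qed
    show "filterlim (\<lambda>k. min_carets (y k)) at_top sequentially"
      unfolding filterlim_at_top
    proof
      fix Z :: nat
      have lim: "filterlim (\<lambda>k. real (Suc k)) at_top sequentially"
        by (rule filterlim_compose[OF filterlim_real_sequentially filterlim_Suc])
      have "filterlim (\<lambda>k. c * (real (Suc k) * ln (real (Suc k)))) at_top sequentially"
        by (rule filterlim_tendsto_pos_mult_at_top[OF tendsto_const c
              filterlim_at_top_mult_at_top[OF lim filterlim_compose[OF ln_at_top lim]]])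
      then have "\<forall>\<^sub>F k in sequentially. C * (real Z * ln (real Z) + 1) < c * (real (Suc k) * ln (real (Suc k)))"
        by (simp add: filterlim_at_top_dense)
      then show "\<forall>\<^sub>F k in sequentially. Z \<le> min_carets (y k)"
      proof eventually_elim
        case (elim k)
        show ?case
        proof (rule ccontr)
          assume "\<not> Z \<le> min_carets (y k)"
          then have "C * (real (min_carets (y k)) * ln (real (min_carets (y k))) + 1) \<le> C * (real Z * ln (real Z) + 1)"
            using C(1) by (intro mult_left_mono add_right_mono mono) auto
          moreover have "real (wl (y k)) \<le> C * (real (min_carets (y k)) * ln (real (min_carets (y k))) + 1)"
            using C(2) z(1) by (simp add: y_def)
          moreover have "c * (real (Suc k) * ln (real (Suc k))) \<le> real (wl (y k))"
            using z(3)[of "Suc k"] by (simp add: y_def)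
          ultimately show False using elim by linarith
        qed
      qed
    qed
  qed
qed

end

theorem theorem3p2:
  fixes S :: "(real \<times> real \<Rightarrow> real \<times> real) set"
  assumes "finite S" and "S \<subseteq> carrier Brin_2V"
    and "generate Brin_2V S = carrier Brin_2V"
  shows "(\<exists>C>0. \<forall>x\<in>carrier Brin_2V. x \<noteq> \<one>\<^bsub>Brin_2V\<^esub> \<longrightarrow>
            ln (real (min_carets x)) \<le> C * real (word_length Brin_2V S x) \<and>
            real (word_length Brin_2V S x)
              \<le> C * (real (min_carets x) * ln (real (min_carets x)) + 1))
       \<and> (\<exists>C'>0. \<exists>x :: nat \<Rightarrow> (real \<times> real \<Rightarrow> real \<times> real).
            (\<forall>k. x k \<in> carrier Brin_2V) \<and>
            filterlim (\<lambda>k. min_carets (x k)) at_top sequentially \<and>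
            (\<forall>k. real (word_length Brin_2V S (x k)) \<le> C' * ln (real (min_carets (x k)))))
       \<and> (\<exists>c>0. \<exists>y :: nat \<Rightarrow> (real \<times> real \<Rightarrow> real \<times> real).
            (\<forall>k. y k \<in> carrier Brin_2V) \<and>
            filterlim (\<lambda>k. min_carets (y k)) at_top sequentially \<and>
            (\<forall>k. real (word_length Brin_2V S (y k))
                   \<ge> c * (real (min_carets (y k)) * ln (real (min_carets (y k))))))"
proof -
  interpret generated_2V S
    using assms Brin_2V_group
    by (simp add: generated_2V_def finitely_generated_group_def finitely_generated_group_axioms_def)
  obtain C1 where C1: "C1 > 0" "\<And>x. x \<in> carrier Brin_2V \<Longrightarrow> x \<noteq> \<one>\<^bsub>Brin_2V\<^esub> \<Longrightarrow>
    ln (real (min_carets x)) \<le> C1 * real (wl x)" using carets_lower_bound by blast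
  obtain C2 where C2: "C2 > 0" "\<And>x. x \<in> carrier Brin_2V \<Longrightarrow>
    real (wl x) \<le> C2 * (real (min_carets x) * ln (real (min_carets x)) + 1)"
    using word_length_upper_bound by blast
  have "\<exists>C>0. \<forall>x\<in>carrier Brin_2V. x \<noteq> \<one>\<^bsub>Brin_2V\<^esub> \<longrightarrow>
            ln (real (min_carets x)) \<le> C * real (wl x) \<and>
            real (wl x) \<le> C * (real (min_carets x) * ln (real (min_carets x)) + 1)"
  proof (intro exI[of _ "C1 + C2"] conjI ballI impI)
    show "0 < C1 + C2" using C1 C2 by simp
    fix x assume x: "x \<in> carrier Brin_2V" "x \<noteq> \<one>\<^bsub>Brin_2V\<^esub>"
    show "ln (real (min_carets x)) \<le> (C1 + C2) * real (wl x)"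
      using C1(2)[OF x] C2(1) mult_right_mono[of C1 "C1 + C2" "real (wl x)"] by linarith
    have "0 \<le> real (min_carets x) * ln (real (min_carets x)) + 1" by (cases "min_carets x = 0") auto
    then show "real (wl x) \<le> (C1 + C2) * (real (min_carets x) * ln (real (min_carets x)) + 1)"
      using C2(2)[OF x(1)] C1(1)
        mult_right_mono[of C2 "C1 + C2" "real (min_carets x) * ln (real (min_carets x)) + 1"] by linarith
  qed
  then show ?thesis using lower_bound_sharp upper_bound_sharp by blast
qed

end
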